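(* Suppose that: (G) for each $t\in\mathbb N$, $\xi_t\sim\mathcal N(0,Q)$; (Q) $\overline{\mathrm{Im}(Q)}=\mathcal H$ (equivalently $\mathrm{Ker}(Q)=\{0\}$); (M1) there is a (measurable) map $m_0:\mathcal H\to\mathcal H$ with $\Psi_0=Q\circ m_0$; (M2) there are constants $c_1,c_2>0$ with $c_1\|Q\|_{\mathcal L}<1$ and $\|m_0(x)\|_{\mathcal H}\le c_1\|x\|_{\mathcal H}+c_2$ for all $x\in\mathcal H$. Then the Markov chain $\{X_t\}_{t\in\mathbb N}$ admits a unique invariant probability distribution $\pi$, and there exist constants $\gamma\in(0,1)$ and $C>0$ such that for all $t\in\mathbb N$ and all $x\in\mathcal H$, $$\sup_{\phi\in\mathcal C_b(\mathcal H),\ \|\phi\|_{\mathcal C_b}\le 1}\Big|(\mathcal P^t\phi)(x)-\int_{\mathcal H}\phi(z)\,\pi(dz)\Big|\le C\gamma^t\,(1+\|x\|_{\mathcal H}).$$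
   Context: Let $d\ge1$, $D=[0,1]^d$ and $\mathcal H=L^2(D)$ (real-valued, Lebesgue measure), with inner product $\langle\cdot,\cdot\rangle_{\mathcal H}$ and norm $\|\cdot\|_{\mathcal H}$. $\|\cdot\|_{\mathcal L}$ denotes the operator norm of a bounded linear operator on $\mathcal H$. On a filtered probability space $(\Omega,\mathcal I,\{\mathcal F_t\},\mathbb P)$ consider the nonlinear functional autoregressive (NFAR) model $X_{t+1}=\Psi_0(X_t)+\xi_t$, $t\in\mathbb N$, where $\Psi_0:\mathcal H\to\mathcal H$ is a measurable (possibly nonlinear) operator, $(X_t)$ is $\{\mathcal F_t\}$-adapted, and $\{\xi_t\}$ are i.i.d. mean-zero $\mathcal H$-valued random elements with $\xi_t$ $\mathcal F_{t+1}$-measurable and independent of $\mathcal F_t$. The covariance kernel is $k(u,v)=\mathbb E[\xi_1(u)\xi_1(v)]$ with $\int_D k(u,u)\,du<\infty$, and $Q$ is the covariance operator $(Qf)(u)=\int_D k(u,v)f(v)\,dv$ (self-adjoint, nonnegative, trace class). $\mathcal N(\mu,Q)$ denotes the Gaussian measure on $\mathcal H$ with mean $\mu$ and covariance operator $Q$. $\mathcal C_b(\mathcal H)$ is the space of bounded measurable $\phi:\mathcal H\to\mathbb R$ with $\|\phi\|_{\mathcal C_b}=\sup_x|\phi(x)|$. For $t\in\mathbb N$, $\mathcal P^t(x,A)=\mathbb P(X_{t+1}\in A\mid X_1=x)$ and $(\mathcal P^t\phi)(x)=\int\phi(z)\mathcal P^t(x,dz)$. *)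

theory Defs
  imports "HOL-Probability.Probability"
begin

definition gaussian_real :: "real \<Rightarrow> real \<Rightarrow> real measure" where
  "gaussian_real m v =
     (if v = 0 then return borel m else density lborel (normal_density m (sqrt v)))"

text \<open>mu is the Gaussian measure N(m, Q) on the real Hilbert space 'h: a Borel probability
  measure all of whose one-dimensional projections x |-> x . h (i.e. all continuous linear
  functionals, by Riesz) are real Gaussian with mean m . h and variance (Q h) . h.\<close>
definition is_gaussian_measure :: "'h::real_inner \<Rightarrow> ('h \<Rightarrow> 'h) \<Rightarrow> 'h measure \<Rightarrow> bool" where
  "is_gaussian_measure m Q mu \<longleftrightarrow>
     prob_space mu \<and> sets mu = sets borel \<and>
     (\<forall>h. distr mu borel (\<lambda>x. x \<bullet> h) = gaussian_real (m \<bullet> h) (Q h \<bullet> h))"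

primrec nfar_path :: "('h::real_vector \<Rightarrow> 'h) \<Rightarrow> (nat \<Rightarrow> 'w \<Rightarrow> 'h) \<Rightarrow> 'h \<Rightarrow> nat \<Rightarrow> 'w \<Rightarrow> 'h" where
  "nfar_path Psi xi x 0 \<omega> = x"
| "nfar_path Psi xi x (Suc t) \<omega> = Psi (nfar_path Psi xi x t \<omega>) + xi t \<omega>"

text \<open>t-step transition probability P^t(x, .) = law of X_{t+1} given X_1 = x.\<close>
definition nfar_kernel :: "'w measure \<Rightarrow> ('h::{real_vector,topological_space} \<Rightarrow> 'h) \<Rightarrow> (nat \<Rightarrow> 'w \<Rightarrow> 'h) \<Rightarrow> nat \<Rightarrow> 'h \<Rightarrow> 'h measure" where
  "nfar_kernel M Psi xi t x = distr M borel (nfar_path Psi xi x t)"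

definition invariant_prob :: "('h::topological_space \<Rightarrow> 'h measure) \<Rightarrow> 'h measure \<Rightarrow> bool" where
  "invariant_prob P \<mu> \<longleftrightarrow>
     prob_space \<mu> \<and> sets \<mu> = sets borel \<and>
     (\<forall>A\<in>sets borel. emeasure \<mu> A = (\<integral>\<^sup>+ x. emeasure (P x) A \<partial>\<mu>))"

end

theory Submission
  imports Defs
begin

text \<open>
  Write m = m0 x. One step of the chain from x has law N(Q m, Q), a shift of \<mu> = N(0, Q) by a vector
  in the range of Q, so by Cameron--Martin it has the density exp (z \<bullet> m - Q m \<bullet> m / 2) with respect
  to \<mu>. Linear growth of m0 bounds this density from below by a multiple of exp (- r * norm z), uniformly
  over x in any fixed ball: every ball is a small set. Since c1 * onorm Q < 1, the norm is a Lyapunov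
  function, and Harris' theorem gives the claim. It is proved in the form of Hairer and Mattingly:
  the transition operator contracts the seminorm sup (f x - f y) / (2 + \<beta> V x + \<beta> V y).

  Cameron--Martin rests on the fact that a finite Borel measure on a separable inner product space
  is determined by its characteristic functional; this is reduced to Levy's one-dimensional theorem.
\<close>

section \<open>Characteristic functionals\<close>

text \<open>The shift lies in the range of Q itself, not merely in that of its square root, so the
  functional in the Cameron--Martin density is an honest inner product with \<open>m0 x\<close>: it
  is bounded by a multiple of the norm of z, and one lower bound serves all x of a ball. Since
  \<open>m0\<close> is only measurable and closed balls need not be compact, a Feller or compactness
  argument for existence is not at hand. The contraction replaces it: the laws started at a point
  are Cauchy uniformly over Borel sets, hence converge setwise, and countable additivity survives in
  the limit. The constant 2 in the seminorm dominates the oscillation of functions bounded by 1; the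
  weight \<beta> is so small that the gain from minorization near the origin outweighs the growth b
  of the drift, while far out the drift contracts by itself. In the uniqueness theorem the
  constraints of a cylinder set are absorbed one at a time into the measures as densities, so it has
  to treat finite measures rather than probabilities.\<close>

lemma finite_measure_char_unique:
  fixes M N :: "real measure"
  assumes "finite_measure M" "finite_measure N" "sets M = sets borel" "sets N = sets borel"
    and char: "char M = char N"
  shows "M = N"
proof -
  interpret M: finite_measure M by fact
  interpret N: finite_measure N by fact
  note [measurable_cong] = assms(3,4)
  have [simp]: "space M = UNIV" "space N = UNIV"
    using assms(3,4)[THEN sets_eq_imp_space_eq] by auto
  have "complex_of_real (measure M UNIV) = complex_of_real (measure N UNIV)"
    using fun_cong[OF char, of 0] by (simp add: char_def)
  then have mass: "measure M UNIV = measure N UNIV" by simp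
  show ?thesis
  proof (cases "measure M UNIV = 0")
    case True
    have "emeasure M A = 0" for A
      using emeasure_space[of M A] True by (simp add: M.emeasure_eq_measure)
    moreover have "emeasure N A = 0" for A
      using N.bounded_measure[of A] True mass by (simp add: N.emeasure_eq_measure measure_le_0_iff)
    ultimately show ?thesis by (intro measure_eqI) (auto simp: assms)
  next
    case False
    \<comment> \<open>Levy's theorem concerns probability measures, so both measures are normalised
      by their common mass, the value of the characteristic function at 0.\<close>
    define c where "c = 1 / measure M UNIV"
    have c: "c > 0" "c * measure M UNIV = 1" using False by (auto simp: c_def zero_less_measure_iff)
    let ?D = "\<lambda>L. density L (\<lambda>_. ennreal c)"
    have rd: "real_distribution (?D L)"
      if "finite_measure L" "sets L = sets borel" "c * measure L UNIV = 1" for L :: "real measure"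
    proof -
      interpret L: finite_measure L by fact
      have "space L = UNIV" using sets_eq_imp_space_eq[OF that(2)] by simp
      then have "emeasure (?D L) (space (?D L)) = 1"
        using that c by (simp add: emeasure_density L.emeasure_eq_measure ennreal_mult'[symmetric])
      then show ?thesis
        unfolding real_distribution_def real_distribution_axioms_def
        using that sets_eq_imp_space_eq[OF that(2)] by (auto intro!: prob_spaceI)
    qed
    have ch: "char (?D L) t = c *\<^sub>R char L t" if [measurable_cong]: "sets L = sets borel" for L t
      unfolding char_def using c by (subst integral_density) (auto simp: that)
    have "char (?D M) = char (?D N)"
      using char by (intro ext) (simp add: ch assms)
    then have eq: "?D M = ?D N"
      using mass c by (intro Levy_uniqueness rd) (auto simp: assms)
    show ?thesis
    proof (rule measure_eqI)
      fix A assume A: "A \<in> sets M"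
      then have "A \<in> sets N" using assms by simp
      then have "ennreal c * emeasure M A = ennreal c * emeasure N A"
        using arg_cong[OF eq, of "\<lambda>L. emeasure L A"] A by (simp add: emeasure_density nn_integral_cmult_indicator)
      then show "emeasure M A = emeasure N A"
        using c by (simp add: ennreal_mult_cancel_left)
    qed (simp add: assms)
  qed
qed

lemma iexp_eq: "iexp x = Complex (cos x) (sin x)"
  by (simp add: complex_eq_iff Re_exp Im_exp)

text \<open>The integrals in the last hypothesis are the characteristic functions of the images
  under \<open>z \<bullet> u\<close> of the measures with density w. Nonnegativity makes these
  densities measures, and the bound B keeps them finite.\<close>

lemma weighted_char_unique:
  fixes M N :: "'h::{real_inner, second_countable_topology} measure"
  assumes "finite_measure M" "finite_measure N" and [measurable_cong]: "sets M = sets borel" "sets N = sets borel"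
    and [measurable]: "w \<in> borel_measurable borel" "A \<in> sets borel" and w: "\<And>z. 0 \<le> w z" "\<And>z. w z \<le> B"
    and eq: "\<And>t. (CLINT z|M. w z *\<^sub>R iexp (t * (z \<bullet> u))) = (CLINT z|N. w z *\<^sub>R iexp (t * (z \<bullet> u)))"
  shows "(\<integral>z. w z * indicator A (z \<bullet> u) \<partial>M) = (\<integral>z. w z * indicator A (z \<bullet> u) \<partial>N)"
proof -
  let ?D = "\<lambda>L. distr (density L (\<lambda>z. ennreal (w z))) borel (\<lambda>z. z \<bullet> u)"
  have fin: "finite_measure (?D L)" if "finite_measure L" and [measurable_cong]: "sets L = sets borel" for L
  proof -
    interpret L: finite_measure L by fact
    have "(\<integral>\<^sup>+z. ennreal (w z) \<partial>L) \<le> (\<integral>\<^sup>+z. ennreal B \<partial>L)"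
      using w by (intro nn_integral_mono ennreal_leI)
    also have "\<dots> < \<infinity>" by (simp add: ennreal_mult_less_top L.emeasure_eq_measure)
    finally have "finite_measure (density L (\<lambda>z. ennreal (w z)))"
      by (intro finite_measureI) (simp add: emeasure_density that(2) sets_eq_imp_space_eq[OF that(2)])
    then show ?thesis by (rule finite_measure.finite_measure_distr) (simp add: that(2))
  qed
  have ch: "char (?D L) t = (CLINT z|L. w z *\<^sub>R iexp (t * (z \<bullet> u)))" if [measurable_cong]: "sets L = sets borel" for L t
    unfolding char_def using w by (simp add: integral_distr integral_density)
  have "?D M = ?D N"
  proof (intro finite_measure_char_unique fin ext)
    show "char (?D M) t = char (?D N) t" for t by (simp only: ch assms)
  qed (use assms in simp_all)
  then have "measure (?D M) A = measure (?D N) A" by simp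
  moreover have "measure (?D L) A = (\<integral>z. w z * indicator A (z \<bullet> u) \<partial>L)"
    if "finite_measure L" and [measurable_cong]: "sets L = sets borel" for L
  proof -
    interpret D: finite_measure "?D L" using fin that by blast
    have "measure (?D L) A = (\<integral>y. indicator A y \<partial>?D L)" by simp
    also have "\<dots> = (\<integral>z. w z * indicator A (z \<bullet> u) \<partial>L)"
      using w by (simp add: integral_distr integral_density del: Bochner_Integration.integral_indicator)
    finally show ?thesis .
  qed
  ultimately show ?thesis using assms(1-4) by simp
qed

text \<open>The product formulas for cos and sin turn an integral with a trigonometric weight into
  values of the unweighted characteristic functional at two shifted vectors.\<close>

lemma cos_mult_iexp: "cos a *\<^sub>R iexp b = (1/2) *\<^sub>R (iexp (b + a) + iexp (b - a))"
  unfolding iexp_eq by (simp add: complex_eq_iff cos_add sin_add cos_diff sin_diff)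

lemma sin_mult_iexp: "sin a *\<^sub>R iexp b = (- \<i> / 2) * (iexp (b + a) - iexp (b - a))"
  unfolding iexp_eq by (simp add: complex_eq_iff cos_add sin_add cos_diff sin_diff field_simps)

text \<open>Weighting with 1, 1 + cos and 1 + sin keeps the measures positive, so that one-dimensional
  uniqueness applies to their images on the line; iterating this lemma gives all cylinder sets.\<close>

lemma restrict_char_unique:
  fixes M N :: "'h::{real_inner, second_countable_topology} measure"
  assumes "finite_measure M" "finite_measure N" and sets[measurable_cong]: "sets M = sets borel" "sets N = sets borel"
    and [measurable]: "A \<in> sets borel"
    and eq: "\<And>h. (CLINT z|M. iexp (z \<bullet> h)) = (CLINT z|N. iexp (z \<bullet> h))"
  shows "(CLINT z|M. indicator A (z \<bullet> u) *\<^sub>R iexp (z \<bullet> h)) = (CLINT z|N. indicator A (z \<bullet> u) *\<^sub>R iexp (z \<bullet> h))"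
proof -
  interpret M: finite_measure M by fact
  interpret N: finite_measure N by fact
  let ?I = "\<lambda>w L. (\<integral>z. (w z :: real) * indicator A (z \<bullet> u) \<partial>L)"
  have int: "integrable L (\<lambda>z. iexp (z \<bullet> v))" "integrable L (\<lambda>z. iexp (t * (z \<bullet> v)))"
    "integrable L (\<lambda>z. cos (z \<bullet> v) *\<^sub>R iexp (t * (z \<bullet> v')))"
    "integrable L (\<lambda>z. sin (z \<bullet> v) *\<^sub>R iexp (t * (z \<bullet> v')))"
    "integrable L (\<lambda>z. indicat_real A (z \<bullet> v))"
    "integrable L (\<lambda>z. cos (z \<bullet> v) * indicat_real A (z \<bullet> v'))"
    "integrable L (\<lambda>z. sin (z \<bullet> v) * indicat_real A (z \<bullet> v'))"
    "integrable L (\<lambda>z. indicat_real A (z \<bullet> v') *\<^sub>R iexp (z \<bullet> v))"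
    if "finite_measure L" and [measurable_cong]: "sets L = sets borel" for L :: "'h measure" and t v v'
    using that(1)
    by (auto intro!: finite_measure.integrable_const_bound[of _ _ 1] simp: abs_mult mult_le_one indicator_def)
  have eqt: "(CLINT z|M. iexp (t * (z \<bullet> v))) = (CLINT z|N. iexp (t * (z \<bullet> v)))" for t v
    using eq[of "t *\<^sub>R v"] by simp
  have cosE: "(CLINT z|L. cos (z \<bullet> h) *\<^sub>R iexp (t * (z \<bullet> v))) =
      (1/2) *\<^sub>R ((CLINT z|L. iexp (z \<bullet> (t *\<^sub>R v + h))) + (CLINT z|L. iexp (z \<bullet> (t *\<^sub>R v - h))))"
    if "finite_measure L" "sets L = sets borel" for L t v
    unfolding cos_mult_iexp using int(1)[OF that, of "t *\<^sub>R v + h"] int(1)[OF that, of "t *\<^sub>R v - h"]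
    by (simp add: inner_add_right inner_diff_right del: of_real_add of_real_diff)
  have sinE: "(CLINT z|L. sin (z \<bullet> h) *\<^sub>R iexp (t * (z \<bullet> v))) =
      (- \<i> / 2) * ((CLINT z|L. iexp (z \<bullet> (t *\<^sub>R v + h))) - (CLINT z|L. iexp (z \<bullet> (t *\<^sub>R v - h))))"
    if "finite_measure L" "sets L = sets borel" for L t v
    unfolding sin_mult_iexp using int(1)[OF that, of "t *\<^sub>R v + h"] int(1)[OF that, of "t *\<^sub>R v - h"]
    by (simp add: inner_add_right inner_diff_right del: of_real_add of_real_diff)
  have 1: "?I (\<lambda>_. 1) M = ?I (\<lambda>_. 1) N"
    using assms eqt by (intro weighted_char_unique[where w="\<lambda>_. 1" and B=1]) simp_all
  have "?I (\<lambda>z. 1 + cos (z \<bullet> h)) M = ?I (\<lambda>z. 1 + cos (z \<bullet> h)) N"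
  proof (intro weighted_char_unique[where B=2])
    show "0 \<le> 1 + cos (z \<bullet> h)" for z using cos_ge_minus_one[of "z \<bullet> h"] by linarith
    show "1 + cos (z \<bullet> h) \<le> 2" for z using cos_le_one[of "z \<bullet> h"] by linarith
    show "(CLINT z|M. (1 + cos (z \<bullet> h)) *\<^sub>R iexp (t * (z \<bullet> u))) = (CLINT z|N. (1 + cos (z \<bullet> h)) *\<^sub>R iexp (t * (z \<bullet> u)))" for t
    proof -
      have "(CLINT z|L. (1 + cos (z \<bullet> h)) *\<^sub>R iexp (t * (z \<bullet> u))) =
          (CLINT z|L. iexp (t * (z \<bullet> u))) + (CLINT z|L. cos (z \<bullet> h) *\<^sub>R iexp (t * (z \<bullet> u)))"
        if "finite_measure L" "sets L = sets borel" for L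
        unfolding scaleR_left_distrib scaleR_one using that by (intro Bochner_Integration.integral_add int)
      then show ?thesis
        by (simp only: eqt cosE assms(1,2) sets eq)
    qed
  qed (use assms in simp_all)
  \<comment> \<open>The summand 1, added only for positivity, is removed by the unweighted
    identity.\<close>
  then have 2: "?I (\<lambda>z. cos (z \<bullet> h)) M = ?I (\<lambda>z. cos (z \<bullet> h)) N"
    using 1 int(5-7)[OF assms(1) sets(1)] int(5-7)[OF assms(2) sets(2)] by (simp add: distrib_right)
  have "?I (\<lambda>z. 1 + sin (z \<bullet> h)) M = ?I (\<lambda>z. 1 + sin (z \<bullet> h)) N"
  proof (intro weighted_char_unique[where B=2])
    show "0 \<le> 1 + sin (z \<bullet> h)" for z using sin_ge_minus_one[of "z \<bullet> h"] by linarith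
    show "1 + sin (z \<bullet> h) \<le> 2" for z using sin_le_one[of "z \<bullet> h"] by linarith
    show "(CLINT z|M. (1 + sin (z \<bullet> h)) *\<^sub>R iexp (t * (z \<bullet> u))) = (CLINT z|N. (1 + sin (z \<bullet> h)) *\<^sub>R iexp (t * (z \<bullet> u)))" for t
    proof -
      have "(CLINT z|L. (1 + sin (z \<bullet> h)) *\<^sub>R iexp (t * (z \<bullet> u))) =
          (CLINT z|L. iexp (t * (z \<bullet> u))) + (CLINT z|L. sin (z \<bullet> h) *\<^sub>R iexp (t * (z \<bullet> u)))"
        if "finite_measure L" "sets L = sets borel" for L
        unfolding scaleR_left_distrib scaleR_one using that by (intro Bochner_Integration.integral_add int)
      then show ?thesis
        by (simp only: eqt sinE assms(1,2) sets eq)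
    qed
  qed (use assms in simp_all)
  then have 3: "?I (\<lambda>z. sin (z \<bullet> h)) M = ?I (\<lambda>z. sin (z \<bullet> h)) N"
    using 1 int(5-7)[OF assms(1) sets(1)] int(5-7)[OF assms(2) sets(2)] by (simp add: distrib_right)
  have "(CLINT z|L. indicator A (z \<bullet> u) *\<^sub>R iexp (z \<bullet> h)) = Complex (?I (\<lambda>z. cos (z \<bullet> h)) L) (?I (\<lambda>z. sin (z \<bullet> h)) L)"
    if "finite_measure L" "sets L = sets borel" for L
    using integral_Re[OF int(8)[OF that, of u h], symmetric] integral_Im[OF int(8)[OF that, of u h], symmetric]
    by (simp add: complex_eq_iff Re_exp Im_exp mult.commute del: integral_Re integral_Im)
  then show ?thesis using 2 3 assms(1,2) sets by simp
qed

section \<open>Cylinder sets and uniqueness on inner product spaces\<close>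

text \<open>Lists of constraints allow an induction that peels off one constraint at a time, and
  make intersection the same as appending.\<close>

definition inner_cylinder :: "('h::real_inner \<times> real set) list \<Rightarrow> 'h set" where
  "inner_cylinder us = {z. \<forall>(u, A)\<in>set us. z \<bullet> u \<in> A}"

lemma inner_cylinder_simps [simp]:
  "inner_cylinder [] = UNIV"
  "inner_cylinder ((u, A) # us) = {z. z \<bullet> u \<in> A} \<inter> inner_cylinder us"
  "inner_cylinder (us @ vs) = inner_cylinder us \<inter> inner_cylinder vs"
  by (auto simp: inner_cylinder_def)

lemma inner_cylinder_measurable:
  fixes us :: "('h::{real_inner, second_countable_topology} \<times> real set) list"
  assumes "\<And>u A. (u, A) \<in> set us \<Longrightarrow> A \<in> sets borel"
  shows "inner_cylinder us \<in> sets borel"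
  using assms
proof (induction us)
  case (Cons p us)
  obtain u A where [simp]: "p = (u, A)" by force
  have [measurable]: "A \<in> sets borel" "inner_cylinder us \<in> sets borel" using Cons by auto
  have "{z::'h. z \<bullet> u \<in> A} \<in> sets borel" by measurable
  then show ?case by simp
qed simp

text \<open>By separability a closed ball is the intersection of countably many half-spaces, whose
  normals run through a dense set, and an open set is a countable union of closed balls.\<close>

lemma sets_borel_eq_inner_cylinder:
  "sets (borel :: 'h::{real_inner, second_countable_topology} measure) =
     sigma_sets UNIV {inner_cylinder us | us. \<forall>(u, A)\<in>set us. A \<in> sets borel}" (is "_ = sigma_sets _ ?E")
proof
  let ?S = "sigma UNIV ?E"
  have setsS: "sets ?S = sigma_sets UNIV ?E" by simp
  obtain D :: "'h set" where D: "countable D" "\<And>X. open X \<Longrightarrow> X \<noteq> {} \<Longrightarrow> \<exists>d\<in>D. d \<in> X"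
    using countable_dense_setE by blast
  have half: "{z. z \<bullet> u \<in> A} \<in> sets ?S" if "A \<in> sets borel" for u A
    unfolding setsS using that by (intro sigma_sets.Basic) (auto intro!: exI[of _ "[(u, A)]"])
  have cb: "cball d q \<in> sets ?S" if "0 \<le> q" for d q
  proof -
    have "cball d q = (\<Inter>h\<in>D. {z. (z - d) \<bullet> h \<le> q * norm h})"
    proof safe
      fix z h assume "z \<in> cball d q"
      then have "norm (z - d) \<le> q" by (simp add: dist_norm norm_minus_commute)
      then show "(z - d) \<bullet> h \<le> q * norm h"
        using norm_cauchy_schwarz[of "z - d" h] by (meson mult_right_mono norm_ge_zero order_trans)
    next
      fix z assume z: "z \<in> (\<Inter>h\<in>D. {z. (z - d) \<bullet> h \<le> q * norm h})"
      show "z \<in> cball d q"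
      proof (rule ccontr)
        assume "z \<notin> cball d q"
        then have q: "q < norm (z - d)" by (simp add: dist_norm norm_minus_commute)
        \<comment> \<open>A point outside the ball is cut off by the direction \<open>z - d\<close>,
          for which Cauchy--Schwarz is an equality; the strict inequality is open, so some direction
          in D does the same.\<close>
        let ?X = "{h. (z - d) \<bullet> h > q * norm h}"
        have "open ?X" by (intro open_Collect_less continuous_intros)
        moreover have "z - d \<in> ?X"
          using q \<open>0 \<le> q\<close> by (auto simp: power2_norm_eq_inner[symmetric] power2_eq_square intro!: mult_strict_right_mono)
        ultimately obtain h where "h \<in> D" "h \<in> ?X" using D(2)[of ?X] by blast
        then show False using z by auto
      qed
    qed
    also have "\<dots> = (\<Inter>h\<in>D. {z. z \<bullet> h \<in> {..q * norm h + d \<bullet> h}})"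
      by (auto simp: inner_diff_left algebra_simps)
    also have "\<dots> \<in> sets ?S"
    proof -
      have "D \<noteq> {}" using D(2)[of UNIV] by auto
      moreover have "{z. z \<bullet> h \<in> {..c}} \<in> sets ?S" for h c by (intro half) simp
      ultimately show ?thesis
        using D(1) by (intro sets.countable_INT' image_subsetI)
    qed
    finally show ?thesis .
  qed
  have "U \<in> sets ?S" if "open U" for U :: "'h set"
  proof -
    let ?P = "{p \<in> D \<times> \<rat>. 0 \<le> snd p \<and> cball (fst p) (snd p) \<subseteq> U}"
    have "U = (\<Union>p\<in>?P. cball (fst p) (snd p))"
    proof safe
      fix x assume "x \<in> U"
      then obtain e where e: "e > 0" "cball x e \<subseteq> U" using \<open>open U\<close> open_contains_cball by blast
      \<comment> \<open>A centre d within q of x gives a ball of radius q that contains x and stays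
        within 2 q < e of it.\<close>
      obtain q where q: "q \<in> \<rat>" "0 < q" "q < e / 2" using Rats_dense_in_real[of 0 "e/2"] e by auto
      obtain d where d: "d \<in> D" "d \<in> ball x q" using D(2)[of "ball x q"] q by auto
      have "cball d q \<subseteq> cball x e"
      proof
        fix w assume "w \<in> cball d q"
        then show "w \<in> cball x e" using dist_triangle[of x w d] d q by simp
      qed
      then show "x \<in> (\<Union>p\<in>?P. cball (fst p) (snd p))"
        using d q e by (intro UN_I[of "(d, q)"]) (auto simp: dist_commute)
    qed auto
    also have "\<dots> \<in> sets ?S"
    proof (intro sets.countable_UN' image_subsetI cb)
      show "countable ?P"
        using D(1) by (intro countable_subset[of ?P "D \<times> \<rat>"]) (auto intro: countable_rat)
    qed auto
    finally show ?thesis .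
  qed
  then have "sigma_sets UNIV {S. open S} \<subseteq> sets ?S"
    using sets.sigma_sets_subset[of "{S. open S}" ?S] by (auto simp: space_measure_of)
  then show "sets (borel :: 'h measure) \<subseteq> sigma_sets UNIV ?E"
    by (simp add: borel_def)
  show "sigma_sets UNIV ?E \<subseteq> sets (borel :: 'h measure)"
    using sets.sigma_sets_subset[of ?E "borel :: 'h measure"] inner_cylinder_measurable by fastforce
qed

text \<open>Cylinder sets form an intersection-stable generator. Agreement on them is by induction
  on the constraints: the first one becomes an indicator density, and by
  \<open>restrict_char_unique\<close> the restricted measures again have equal characteristic
  functionals. Hence the induction must be general in M and N.\<close>

theorem char_functional_unique:
  fixes M N :: "'h::{real_inner, second_countable_topology} measure"
  assumes "finite_measure M" "finite_measure N" "sets M = sets borel" "sets N = sets borel"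
    and "\<And>h. (CLINT z|M. iexp (z \<bullet> h)) = (CLINT z|N. iexp (z \<bullet> h))"
  shows "M = N"
proof -
  have cyl: "emeasure M (inner_cylinder us) = emeasure N (inner_cylinder us)"
    if "\<forall>(u, A)\<in>set us. A \<in> sets borel"
      "finite_measure M" "finite_measure N" "sets M = sets borel" "sets N = sets borel"
      "\<And>h. (CLINT z|M. iexp (z \<bullet> h)) = (CLINT z|N. iexp (z \<bullet> h))" for M N :: "'h measure" and us
    using that
  proof (induction us arbitrary: M N)
    case Nil
    interpret M: finite_measure M by fact
    interpret N: finite_measure N by fact
    have "space M = UNIV" "space N = UNIV" using Nil(4,5)[THEN sets_eq_imp_space_eq] by auto
    \<comment> \<open>At h = 0 the characteristic functional is the total mass.\<close>
    then show ?case
      using Nil(6)[of 0] by (simp add: M.emeasure_eq_measure N.emeasure_eq_measure)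
  next
    case (Cons p us)
    obtain u A where [simp]: "p = (u, A)" by force
    have us: "\<forall>(u, A)\<in>set us. A \<in> sets borel" and A[measurable]: "A \<in> sets borel" using Cons by auto
    have [measurable]: "inner_cylinder us \<in> sets borel" using us by (intro inner_cylinder_measurable) auto
    let ?w = "\<lambda>z. indicator A (z \<bullet> u) :: real"
    let ?D = "\<lambda>L. density L (\<lambda>z. ennreal (?w z))"
    have ch: "(CLINT z|?D L. iexp (z \<bullet> h)) = (CLINT z|L. ?w z *\<^sub>R iexp (z \<bullet> h))"
      if [measurable_cong]: "sets L = sets borel" for L h
      by (subst integral_density) auto
    have fin: "finite_measure (?D L)" if "finite_measure L" and [measurable_cong]: "sets L = sets borel" for L
    proof -
      interpret L: finite_measure L by fact
      have "(\<integral>\<^sup>+z. ennreal (?w z) \<partial>L) \<le> (\<integral>\<^sup>+z. 1 \<partial>L)"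
        by (intro nn_integral_mono) (auto simp: indicator_def)
      also have "\<dots> < \<infinity>" by (simp add: L.emeasure_eq_measure)
      finally show ?thesis
        by (intro finite_measureI) (simp add: emeasure_density that(2) sets_eq_imp_space_eq[OF that(2)])
    qed
    have em: "emeasure (?D L) (inner_cylinder us) = emeasure L (inner_cylinder (p # us))"
      if [measurable_cong, simp]: "sets L = sets borel" for L
    proof -
      have "emeasure (?D L) (inner_cylinder us) = (\<integral>\<^sup>+z. indicator (inner_cylinder (p # us)) z \<partial>L)"
      proof (subst emeasure_density)
        show "(\<integral>\<^sup>+z. ennreal (?w z) * indicator (inner_cylinder us) z \<partial>L) = (\<integral>\<^sup>+z. indicator (inner_cylinder (p # us)) z \<partial>L)"
          by (intro nn_integral_cong) (auto split: split_indicator)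
      qed auto
      also have "\<dots> = emeasure L (inner_cylinder (p # us))"
        using Cons(2) by (subst nn_integral_indicator) (auto simp del: inner_cylinder_simps intro!: inner_cylinder_measurable)
      finally show ?thesis .
    qed
    have "emeasure (?D M) (inner_cylinder us) = emeasure (?D N) (inner_cylinder us)"
      using Cons.prems restrict_char_unique[of M N A u]
      by (intro Cons.IH us fin) (simp_all add: ch)
    then show ?case using Cons.prems by (simp add: em del: inner_cylinder_simps)
  qed
  let ?E = "{inner_cylinder us :: 'h set | us. \<forall>(u, A)\<in>set us. A \<in> sets borel}"
  show ?thesis
  proof (rule measure_eqI_generator_eq[where E="?E" and \<Omega>=UNIV and A="\<lambda>_. UNIV"])
    show "Int_stable ?E"
    proof (rule Int_stableI, clarify)
      fix us vs :: "('h \<times> real set) list"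
      assume "\<forall>(u, A)\<in>set us. A \<in> sets borel" "\<forall>(u, A)\<in>set vs. A \<in> sets borel"
      then show "\<exists>ws. inner_cylinder us \<inter> inner_cylinder vs = inner_cylinder ws \<and> (\<forall>(u, A)\<in>set ws. A \<in> sets borel)"
        by (intro exI[of _ "us @ vs"]) auto
    qed
    show "emeasure M X = emeasure N X" if "X \<in> ?E" for X
      using that assms by (auto intro!: cyl)
    show "range (\<lambda>_. UNIV) \<subseteq> ?E" by (auto intro!: exI[of _ "[]"])
    show "emeasure M UNIV \<noteq> \<infinity>" for i using finite_measure.emeasure_finite[OF assms(1)] by simp
    show "sets M = sigma_sets UNIV ?E" "sets N = sigma_sets UNIV ?E"
      using assms(3,4) sets_borel_eq_inner_cylinder by (auto intro: trans)
  qed auto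
qed

section \<open>Gaussian measures\<close>

lemma sets_gaussian_real [simp, measurable_cong]: "sets (gaussian_real m v) = sets borel"
  by (simp add: gaussian_real_def)

text \<open>As an affine image of the standard normal law, the point mass v = 0 needs no separate
  treatment in later computations.\<close>

lemma gaussian_real_eq_distr:
  assumes "0 \<le> v"
  shows "gaussian_real m v = distr std_normal_distribution borel (\<lambda>y. m + sqrt v * y)"
proof (cases "v = 0")
  case True
  interpret prob_space std_normal_distribution by (rule prob_space_normal_density) simp
  have "distr std_normal_distribution borel (\<lambda>y. m) = return borel m"
    by (rule distr_const) simp
  with True show ?thesis by (simp add: gaussian_real_def)
next
  case False
  interpret prob_space std_normal_distribution by (rule prob_space_normal_density) simp
  have "distributed std_normal_distribution lborel (\<lambda>x. x) std_normal_density"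
    by (auto simp: distributed_def distr_id2)
  then have "distributed std_normal_distribution lborel (\<lambda>x. m + sqrt v * x) (normal_density (m + sqrt v * 0) (\<bar>sqrt v\<bar> * 1))"
    using False by (intro normal_density_affine) auto
  then show ?thesis
    using False assms by (simp add: gaussian_real_def distributed_def distr_cong[OF refl sets_lborel])
qed

lemma prob_space_gaussian_real: "0 \<le> v \<Longrightarrow> prob_space (gaussian_real m v)"
  unfolding gaussian_real_eq_distr
  by (intro prob_space.prob_space_distr prob_space_normal_density) auto

lemma char_gaussian_real:
  assumes "0 \<le> v"
  shows "char (gaussian_real m v) t = iexp (t * m) * exp (- (v * t\<^sup>2) / 2)"
proof -
  have "char (gaussian_real m v) t = (CLINT y|std_normal_distribution. iexp (t * m) * iexp ((t * sqrt v) * y))"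
    unfolding char_def gaussian_real_eq_distr[OF assms]
    by (subst integral_distr) (auto simp: exp_add[symmetric] algebra_simps)
  also have "\<dots> = iexp (t * m) * char std_normal_distribution (t * sqrt v)"
    by (simp add: char_def)
  finally show ?thesis
    using assms by (simp add: char_std_normal_distribution power_mult_distrib mult.commute)
qed

text \<open>One-dimensional Cameron--Martin formula, by completing the square. A tilt of slope 1
  moves the mean by the variance, hence the repeated v on the right.\<close>

lemma density_exp_gaussian_real:
  assumes "0 \<le> v"
  shows "density (gaussian_real 0 v) (\<lambda>y. ennreal (exp (y - v / 2))) = gaussian_real v v"
proof (cases "v = 0")
  case True
  have "density (return borel (0::real)) (\<lambda>y. ennreal (exp y)) = return borel 0"
    by (rule measure_eqI) (auto simp: emeasure_density nn_integral_return)
  with True show ?thesis by (simp add: gaussian_real_def)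
next
  case False
  then have v: "0 < v" using assms by simp
  have "normal_density 0 (sqrt v) y * exp (y - v / 2) = normal_density v (sqrt v) y" for y
  proof -
    have "- y\<^sup>2 / (2 * v) + (y - v / 2) = - (y - v)\<^sup>2 / (2 * v)"
      using v by (simp add: field_simps power2_eq_square)
    then have "exp (- y\<^sup>2 / (2 * v)) * exp (y - v / 2) = exp (- (y - v)\<^sup>2 / (2 * v))"
      by (simp only: exp_add[symmetric])
    then show ?thesis using v by (simp add: normal_density_def)
  qed
  then show ?thesis
    using v by (simp add: gaussian_real_def density_density_eq ennreal_mult'[symmetric])
qed

text \<open>The Gaussian law speaks only of the quadratic form \<open>Q h \<bullet> h\<close>;
  linearity and symmetry give access to the mixed terms \<open>Q u \<bullet> w\<close>.\<close>

locale centered_gaussian =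
  fixes Q :: "'h::{real_inner, second_countable_topology} \<Rightarrow> 'h" and \<mu> :: "'h measure"
  assumes gaussian: "is_gaussian_measure 0 Q \<mu>"
    and linear: "linear Q"
    and symmetric: "\<And>f g. Q f \<bullet> g = f \<bullet> Q g"
    and nonneg: "\<And>f. 0 \<le> Q f \<bullet> f"
begin

sublocale prob_space \<mu>
  using gaussian by (simp add: is_gaussian_measure_def)

lemma sets_eq [simp, measurable_cong]: "sets \<mu> = sets borel"
  using gaussian by (simp add: is_gaussian_measure_def)

lemma space_eq [simp]: "space \<mu> = UNIV"
  using sets_eq_imp_space_eq[OF sets_eq] by simp

lemma distr_inner: "distr \<mu> borel (\<lambda>z. z \<bullet> h) = gaussian_real 0 (Q h \<bullet> h)"
  using gaussian by (simp add: is_gaussian_measure_def)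

lemma char_functional: "(CLINT z|\<mu>. iexp (z \<bullet> h)) = exp (- (Q h \<bullet> h) / 2)"
proof -
  have "(CLINT z|\<mu>. iexp (z \<bullet> h)) = char (distr \<mu> borel (\<lambda>z. z \<bullet> h)) 1"
    unfolding char_def by (subst integral_distr) auto
  then show ?thesis by (simp add: distr_inner char_gaussian_real nonneg)
qed

text \<open>Uncorrelated jointly Gaussian variables are independent: without the cross term the
  quadratic form of \<open>s *\<^sub>R u + t *\<^sub>R w\<close> splits, so joint law and product of
  the marginals have the same characteristic functional on the plane, where
  \<open>char_functional_unique\<close> applies.\<close>

lemma indep_var_inner:
  assumes "Q u \<bullet> w = 0"
  shows "indep_var borel (\<lambda>z. z \<bullet> u) borel (\<lambda>z. z \<bullet> w)"
proof -
  let ?U = "distr \<mu> borel (\<lambda>z. z \<bullet> u)" and ?W = "distr \<mu> borel (\<lambda>z. z \<bullet> w)"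
  let ?J = "distr \<mu> (borel \<Otimes>\<^sub>M borel) (\<lambda>z. (z \<bullet> u, z \<bullet> w))"
  interpret U: prob_space ?U by (intro prob_space_distr) simp
  interpret W: prob_space ?W by (intro prob_space_distr) simp
  interpret UW: pair_prob_space ?U ?W ..
  interpret J: prob_space ?J by (intro prob_space_distr) simp
  have "?U \<Otimes>\<^sub>M ?W = ?J"
  proof (rule char_functional_unique)
    fix h :: "real \<times> real"
    obtain s t where h: "h = (s, t)" by force
    have Qst: "Q (s *\<^sub>R u + t *\<^sub>R w) \<bullet> (s *\<^sub>R u + t *\<^sub>R w) = s\<^sup>2 * (Q u \<bullet> u) + t\<^sup>2 * (Q w \<bullet> w)"
      using assms symmetric[of w u]
      by (simp add: linear_add[OF linear] linear_scale[OF linear] inner_add_left inner_add_right power2_eq_square inner_commute)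
    have "(CLINT p|?U \<Otimes>\<^sub>M ?W. iexp (p \<bullet> h)) = (CLINT p|?U \<Otimes>\<^sub>M ?W. iexp (s * fst p) * iexp (t * snd p))"
      by (simp add: h inner_prod_def exp_add[symmetric] algebra_simps)
    also have "\<dots> = (CLINT a|?U. CLINT b|?W. iexp (s * a) * iexp (t * b))"
      by (subst UW.integral_fst'[symmetric]) (auto intro!: UW.integrable_const_bound[of _ 1] simp: norm_mult)
    also have "\<dots> = char ?U s * char ?W t"
      by (simp add: char_def)
    also have "\<dots> = exp (- (Q (s *\<^sub>R u + t *\<^sub>R w) \<bullet> (s *\<^sub>R u + t *\<^sub>R w)) / 2)"
      unfolding Qst
      by (simp add: distr_inner char_gaussian_real nonneg exp_add[symmetric] exp_of_real[symmetric] field_simps add_divide_distrib del: exp_of_real)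
    also have "\<dots> = (CLINT z|\<mu>. iexp (z \<bullet> (s *\<^sub>R u + t *\<^sub>R w)))"
      by (rule char_functional[symmetric])
    also have "\<dots> = (CLINT p|?J. iexp (p \<bullet> h))"
      by (subst integral_distr) (auto simp: h inner_prod_def inner_add_right mult.commute)
    finally show "(CLINT p|?U \<Otimes>\<^sub>M ?W. iexp (p \<bullet> h)) = (CLINT p|?J. iexp (p \<bullet> h))" .
    show "sets (?U \<Otimes>\<^sub>M ?W) = sets borel" "sets ?J = sets borel"
      by (metis borel_prod sets_distr sets_pair_measure_cong)+
  qed (rule UW.finite_measure_axioms J.finite_measure_axioms)+
  then show ?thesis by (simp add: indep_var_distribution_eq)
qed

text \<open>Degenerate case of Cauchy--Schwarz for the form of Q: along
  \<open>Q m + t *\<^sub>R m\<close> the quadratic term vanishes, and an affine function of t that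
  is nonnegative everywhere has slope 0.\<close>

lemma zero_variance:
  assumes "Q m \<bullet> m = 0"
  shows "Q m = 0"
proof (rule ccontr)
  assume "Q m \<noteq> 0"
  then have pos: "Q m \<bullet> Q m > 0" by simp
  define c where "c = Q (Q m) \<bullet> Q m"
  have "0 \<le> c + 2 * t * (Q m \<bullet> Q m)" for t
    using nonneg[of "Q m + t *\<^sub>R m"] assms symmetric[of "Q m" m]
    by (simp add: c_def linear_add[OF linear] linear_scale[OF linear] inner_add_left inner_add_right inner_commute)
  \<comment> \<open>This t makes the affine function equal to -1.\<close>
  from this[of "- (c + 1) / (2 * (Q m \<bullet> Q m))"] pos show False by (simp add: field_simps)
qed

text \<open>Splitting h into a multiple of m and a part that is Q-orthogonal to m
  reduces the exponential tilt to dimension one. In the degenerate case Q m \<bullet> m = 0 the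
  division by zero below correctly gives the multiple 0.\<close>

theorem cameron_martin:
  "distr \<mu> borel (\<lambda>z. Q m + z) = density \<mu> (\<lambda>z. ennreal (exp (z \<bullet> m - (Q m \<bullet> m) / 2)))"
    (is "?D = density \<mu> (\<lambda>z. ennreal (?e z))")
proof (rule char_functional_unique)
  define v where "v = Q m \<bullet> m"
  have v: "0 \<le> v" by (simp add: v_def nonneg)
  interpret G: prob_space "gaussian_real v v" by (rule prob_space_gaussian_real[OF v])
  have push: "distr (density \<mu> (\<lambda>z. ennreal (?e z))) borel (\<lambda>z. z \<bullet> m) = gaussian_real v v"
  proof -
    have "distr (density \<mu> (\<lambda>z. ennreal (?e z))) borel (\<lambda>z. z \<bullet> m) =
        density (distr \<mu> borel (\<lambda>z. z \<bullet> m)) (\<lambda>y. ennreal (exp (y - v / 2)))"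
    proof (rule measure_eqI)
      fix A :: "real set"
      assume "A \<in> sets (distr (density \<mu> (\<lambda>z. ennreal (?e z))) borel (\<lambda>z. z \<bullet> m))"
      then have [measurable]: "A \<in> sets borel" by simp
      have [measurable]: "(\<lambda>z. z \<bullet> m) -` A \<in> sets borel"
        by (rule measurable_sets_borel[where M=borel]) auto
      show "emeasure (distr (density \<mu> (\<lambda>z. ennreal (?e z))) borel (\<lambda>z. z \<bullet> m)) A =
          emeasure (density (distr \<mu> borel (\<lambda>z. z \<bullet> m)) (\<lambda>y. ennreal (exp (y - v / 2)))) A"
        by (simp add: emeasure_distr emeasure_density nn_integral_distr v_def indicator_vimage)
    qed simp
    then show ?thesis by (simp add: distr_inner v_def[symmetric] density_exp_gaussian_real v)
  qed
  show "finite_measure ?D" by (intro finite_measure_distr) simp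
  show "finite_measure (density \<mu> (\<lambda>z. ennreal (?e z)))"
  proof (rule finite_measureI)
    \<comment> \<open>The density is in general unbounded; its total mass is read off from the image
      on the line, which is a probability measure.\<close>
    have "emeasure (density \<mu> (\<lambda>z. ennreal (?e z))) UNIV = emeasure (gaussian_real v v) UNIV"
      by (simp add: push[symmetric] emeasure_distr)
    then show "emeasure (density \<mu> (\<lambda>z. ennreal (?e z))) (space (density \<mu> (\<lambda>z. ennreal (?e z)))) \<noteq> \<infinity>"
      by simp
  qed
  have tilt: "(CLINT z|\<mu>. ?e z *\<^sub>R iexp (a * (z \<bullet> m))) = iexp (a * v) * exp (- (v * a\<^sup>2) / 2)"
    and tilt_int: "integrable \<mu> (\<lambda>z. ?e z *\<^sub>R iexp (a * (z \<bullet> m)))" for a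
  proof -
    have "(CLINT z|\<mu>. ?e z *\<^sub>R iexp (a * (z \<bullet> m))) = char (gaussian_real v v) a"
      unfolding char_def push[symmetric]
      by (subst integral_distr; (subst integral_density)?) auto
    then show "(CLINT z|\<mu>. ?e z *\<^sub>R iexp (a * (z \<bullet> m))) = iexp (a * v) * exp (- (v * a\<^sup>2) / 2)"
      by (simp add: char_gaussian_real v)
    have "integrable (gaussian_real v v) (\<lambda>y. iexp (a * y))"
      by (intro G.integrable_const_bound[of _ 1]) auto
    then show "integrable \<mu> (\<lambda>z. ?e z *\<^sub>R iexp (a * (z \<bullet> m)))"
      unfolding push[symmetric] by (simp add: integrable_distr_eq integrable_density)
  qed
  fix h
  define a where "a = (Q m \<bullet> h) / v"
  define k where "k = h - a *\<^sub>R m"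
  \<comment> \<open>For v = 0 both sides vanish, because then Q m = 0.\<close>
  have av: "a * v = Q m \<bullet> h"
    using zero_variance[of m] by (cases "v = 0") (auto simp: a_def v_def)
  have orth: "Q m \<bullet> k = 0" by (simp add: k_def inner_diff_right av[symmetric] v_def)
  have h: "h = a *\<^sub>R m + k" by (simp add: k_def)
  have Qh: "Q h \<bullet> h = a\<^sup>2 * v + Q k \<bullet> k"
    using orth symmetric[of k m]
    by (simp add: h v_def linear_add[OF linear] linear_scale[OF linear] inner_add_left inner_add_right power2_eq_square inner_commute)
  \<comment> \<open>The tilt depends on \<open>z \<bullet> m\<close> alone, so the integral factors
    into a tilted one-dimensional part and an untilted Gaussian part.\<close>
  have "indep_var borel ((\<lambda>y. exp (y - v / 2) *\<^sub>R iexp (a * y)) \<circ> (\<lambda>z. z \<bullet> m)) borel (iexp \<circ> (\<lambda>z. z \<bullet> k))"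
    using indep_var_inner[OF orth] by (rule indep_var_compose) auto
  then have ind: "indep_var borel (\<lambda>z. ?e z *\<^sub>R iexp (a * (z \<bullet> m))) borel (\<lambda>z. iexp (z \<bullet> k))"
    by (simp add: comp_def v_def)
  have "(CLINT z|density \<mu> (\<lambda>z. ennreal (?e z)). iexp (z \<bullet> h)) = (CLINT z|\<mu>. ?e z *\<^sub>R iexp (z \<bullet> h))"
    by (subst integral_density) auto
  also have "\<dots> = (CLINT z|\<mu>. (?e z *\<^sub>R iexp (a * (z \<bullet> m))) * iexp (z \<bullet> k))"
    by (rule Bochner_Integration.integral_cong)
       (simp_all add: h inner_add_right distrib_left exp_add)
  also have "\<dots> = (CLINT z|\<mu>. ?e z *\<^sub>R iexp (a * (z \<bullet> m))) * (CLINT z|\<mu>. iexp (z \<bullet> k))"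
    by (intro indep_var_lebesgue_integral ind tilt_int integrable_const_bound[of _ 1]) auto
  also have "\<dots> = iexp (Q m \<bullet> h) * (exp (- (v * a\<^sup>2) / 2) * exp (- (Q k \<bullet> k) / 2))"
    unfolding tilt char_functional av by (simp add: mult.assoc)
  also have "exp (- (v * a\<^sup>2) / 2) * exp (- (Q k \<bullet> k) / 2) = exp (- (Q h \<bullet> h) / 2)"
    unfolding Qh exp_add[symmetric] by (simp add: field_simps)
  also have "iexp (Q m \<bullet> h) * complex_of_real (exp (- (Q h \<bullet> h) / 2)) = (CLINT z|\<mu>. iexp (Q m \<bullet> h) * iexp (z \<bullet> h))"
    by (simp only: char_functional[of h, symmetric] integral_mult_right_zero)
  also have "\<dots> = (CLINT z|?D. iexp (z \<bullet> h))"
    by (subst integral_distr) (auto simp: inner_add_left distrib_left exp_add)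
  finally show "(CLINT z|?D. iexp (z \<bullet> h)) = (CLINT z|density \<mu> (\<lambda>z. ennreal (?e z)). iexp (z \<bullet> h))" by simp
qed auto

end

section \<open>Harris' theorem\<close>

text \<open>The new step is appended at the end, as in the recursion of
  \<open>nfar_path\<close>.\<close>

primrec kernel_pow :: "('a::topological_space \<Rightarrow> 'a measure) \<Rightarrow> nat \<Rightarrow> 'a \<Rightarrow> 'a measure" where
  "kernel_pow K 0 x = return borel x"
| "kernel_pow K (Suc n) x = kernel_pow K n x \<bind> K"

lemma borel_kernelD:
  assumes "K \<in> borel \<rightarrow>\<^sub>M prob_algebra borel"
  shows "prob_space (K x)" "sets (K x) = sets borel" "space (K x) = UNIV"
proof -
  have "K x \<in> space (prob_algebra borel)" using measurable_space[OF assms, of x] by simp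
  then show 1: "prob_space (K x)" "sets (K x) = sets borel" by (auto simp: space_prob_algebra)
  from sets_eq_imp_space_eq[OF 1(2)] show "space (K x) = UNIV" by simp
qed

lemma kernel_pow_measurable [measurable]:
  assumes [measurable]: "K \<in> borel \<rightarrow>\<^sub>M prob_algebra borel"
  shows "kernel_pow K n \<in> borel \<rightarrow>\<^sub>M prob_algebra borel"
proof (induction n)
  case 0
  have "(\<lambda>x. return borel x) \<in> borel \<rightarrow>\<^sub>M prob_algebra (borel :: 'a measure)"
    by (intro measurable_prob_algebraI prob_space_return) auto
  then show ?case by simp
next
  case (Suc n)
  show ?case unfolding kernel_pow.simps by (rule measurable_bind_prob_space[OF Suc assms])
qed

lemma kernel_pow_add:
  assumes K: "K \<in> borel \<rightarrow>\<^sub>M prob_algebra borel"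
  shows "kernel_pow K (m + n) x = kernel_pow K m x \<bind> kernel_pow K n"
proof (induction n)
  case 0
  show ?case
    using borel_kernelD[OF kernel_pow_measurable[OF K]] by (simp add: bind_return'' eta_contract_eq)
next
  case (Suc n)
  have "kernel_pow K (m + Suc n) x = (kernel_pow K m x \<bind> kernel_pow K n) \<bind> K"
    using Suc by simp
  also have "\<dots> = kernel_pow K m x \<bind> (\<lambda>y. kernel_pow K n y \<bind> K)"
    using borel_kernelD(2)[OF kernel_pow_measurable[OF K], of m x]
    by (intro bind_assoc[where N=borel and R=borel] measurable_prob_algebraD K)
       (auto intro!: measurable_prob_algebraD kernel_pow_measurable K cong: measurable_cong_sets)
  finally show ?case by simp
qed

section \<open>Setwise limits of probability measures\<close>

text \<open>The rate \<open>a n\<close> is uniform in A. This carries continuity at the empty set,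
  and with it countable additivity, from one fixed \<open>p n\<close> to the limit.\<close>

lemma setwise_limit_measure:
  fixes p :: "nat \<Rightarrow> 'a measure"
  assumes p: "\<And>n. prob_space (p n)" and sets: "\<And>n. sets (p n) = sets S"
    and cauchy: "\<And>n m A. n \<le> m \<Longrightarrow> A \<in> sets S \<Longrightarrow> \<bar>measure (p n) A - measure (p m) A\<bar> \<le> a n"
    and a: "a \<longlonglongrightarrow> 0"
  obtains \<pi> where "prob_space \<pi>" "sets \<pi> = sets S" "\<And>A. A \<in> sets S \<Longrightarrow> (\<lambda>n. measure (p n) A) \<longlonglongrightarrow> measure \<pi> A"
proof -
  define l where "l A = lim (\<lambda>n. measure (p n) A)" for A
  have conv: "(\<lambda>n. measure (p n) A) \<longlonglongrightarrow> l A" if A: "A \<in> sets S" for A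
  proof -
    have "Cauchy (\<lambda>n. measure (p n) A)"
    proof (rule metric_CauchyI)
      fix e :: real assume "0 < e"
      then have "\<forall>\<^sub>F n in sequentially. a n < e / 2" using order_tendstoD(2)[OF a, of "e/2"] by simp
      then obtain N where N: "a N < e / 2" by (auto simp: eventually_sequentially)
      have "dist (measure (p m) A) (measure (p n) A) < e" if "N \<le> m" "N \<le> n" for m n
        using cauchy[OF that(1) A] cauchy[OF that(2) A] N by (simp add: dist_real_def)
      then show "\<exists>N. \<forall>m\<ge>N. \<forall>n\<ge>N. dist (measure (p m) A) (measure (p n) A) < e" by blast
    qed
    then show ?thesis by (simp add: l_def Cauchy_convergent_iff convergent_LIMSEQ_iff)
  qed
  \<comment> \<open>Let m tend to infinity in the Cauchy estimate.\<close>
  have rate: "\<bar>measure (p n) A - l A\<bar> \<le> a n" if "A \<in> sets S" for n A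
  proof (rule LIMSEQ_le_const2)
    show "(\<lambda>m. \<bar>measure (p n) A - measure (p m) A\<bar>) \<longlonglongrightarrow> \<bar>measure (p n) A - l A\<bar>"
      by (intro tendsto_intros conv that)
    show "\<exists>N. \<forall>m\<ge>N. \<bar>measure (p n) A - measure (p m) A\<bar> \<le> a n" using cauchy that by blast
  qed
  have l_nonneg: "0 \<le> l A" if "A \<in> sets S" for A
    using conv[OF that] by (rule LIMSEQ_le_const) simp
  have l_empty: "l {} = 0"
    using conv[of "{}"] by (simp add: LIMSEQ_const_iff)
  have "positive (sets S) (\<lambda>A. ennreal (l A))" by (simp add: positive_def l_empty)
  moreover have "countably_additive (sets S) (\<lambda>A. ennreal (l A))"
  proof (rule sets.empty_continuous_imp_countably_additive)
    show "additive (sets S) (\<lambda>A. ennreal (l A))"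
    proof (unfold additive_def, intro ballI impI)
      fix A B assume AB: "A \<in> sets S" "B \<in> sets S" "A \<inter> B = {}"
      have "measure (p n) (A \<union> B) = measure (p n) A + measure (p n) B" for n
        using finite_measure.finite_measure_Union[of "p n" A B] p[of n] AB sets
        by (simp add: prob_space_def)
      then have "(\<lambda>n. measure (p n) A + measure (p n) B) \<longlonglongrightarrow> l (A \<union> B)"
        using conv[of "A \<union> B"] AB by simp
      moreover have "(\<lambda>n. measure (p n) A + measure (p n) B) \<longlonglongrightarrow> l A + l B"
        by (intro tendsto_add conv AB)
      ultimately have "l (A \<union> B) = l A + l B" by (rule LIMSEQ_unique)
      then show "ennreal (l (A \<union> B)) = ennreal (l A) + ennreal (l B)"
        using l_nonneg AB by (simp add: ennreal_plus)
    qed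
    fix A :: "nat \<Rightarrow> 'a set" assume A: "range A \<subseteq> sets S" "decseq A" "(\<Inter>i. A i) = {}"
    have "(\<lambda>i. l (A i)) \<longlonglongrightarrow> 0"
    proof (rule LIMSEQ_I)
      fix e :: real assume "0 < e"
      then have "\<forall>\<^sub>F n in sequentially. a n < e / 2" using order_tendstoD(2)[OF a, of "e/2"] by simp
      then obtain n where n: "a n < e / 2" by (auto simp: eventually_sequentially)
      interpret P: prob_space "p n" by (rule p)
      have "(\<lambda>i. measure (p n) (A i)) \<longlonglongrightarrow> 0"
        using P.finite_Lim_measure_decseq[of A] A sets by simp
      then have "\<forall>\<^sub>F i in sequentially. measure (p n) (A i) < e / 2"
        using order_tendstoD(2)[of _ 0 _ "e/2"] \<open>0 < e\<close> by simp
      then obtain N where N: "\<And>i. i \<ge> N \<Longrightarrow> measure (p n) (A i) < e / 2"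
        by (auto simp: eventually_sequentially)
      have "norm (l (A i) - 0) < e" if "i \<ge> N" for i
        using N[OF that] rate[of "A i" n] l_nonneg[of "A i"] n A by (auto simp: abs_le_iff)
      then show "\<exists>N. \<forall>i\<ge>N. norm (l (A i) - 0) < e" by blast
    qed
    then show "(\<lambda>i. ennreal (l (A i))) \<longlonglongrightarrow> 0"
      using tendsto_ennrealI[of "\<lambda>i. l (A i)" 0] by simp
  qed (auto simp: positive_def l_empty)
  ultimately have em: "emeasure (measure_of (space S) (sets S) (\<lambda>A. ennreal (l A))) A = ennreal (l A)"
    if "A \<in> sets S" for A
    using that by (intro emeasure_measure_of_sigma) (auto simp: sets.sigma_algebra_axioms)
  let ?\<pi> = "measure_of (space S) (sets S) (\<lambda>A. ennreal (l A))"
  have "(\<lambda>n. measure (p n) (space S)) = (\<lambda>_. 1)"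
    using prob_space.prob_space[OF p] sets_eq_imp_space_eq[OF sets] by simp
  then have "l (space S) = 1" using conv[of "space S"] by (simp add: LIMSEQ_const_iff)
  then have "prob_space ?\<pi>" by (intro prob_spaceI) (simp add: em)
  moreover have "measure ?\<pi> A = l A" if "A \<in> sets S" for A
    using that by (simp add: measure_def em l_nonneg)
  ultimately show ?thesis using conv by (intro that[of ?\<pi>]) auto
qed

text \<open>A Fatou lemma with varying measures: integrals of a simple function below f converge,
  and the integral of f is their supremum.\<close>

lemma nn_integral_setwise_liminf:
  fixes p :: "nat \<Rightarrow> 'a measure"
  assumes p: "\<And>n. prob_space (p n)" "\<And>n. sets (p n) = sets \<pi>" and \<pi>: "prob_space \<pi>"
    and conv: "\<And>A. A \<in> sets \<pi> \<Longrightarrow> (\<lambda>n. measure (p n) A) \<longlonglongrightarrow> measure \<pi> A"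
    and bound: "\<And>n. (\<integral>\<^sup>+x. f x \<partial>p n) \<le> b n" and b: "b \<longlonglongrightarrow> B"
  shows "(\<integral>\<^sup>+x. f x \<partial>\<pi>) \<le> B"
  \<comment> \<open>The supremum is taken over simple functions with finite values only, since
    multiplication by infinity is not continuous at 0.\<close>
  unfolding nn_integral_def_finite
proof (rule SUP_least, clarify)
  fix s assume s: "simple_function \<pi> s" "s \<le> f" "\<forall>x. s x < top"
  interpret \<pi>: prob_space \<pi> by (rule \<pi>)
  have sp: "space (p n) = space \<pi>" for n by (rule sets_eq_imp_space_eq[OF p(2)])
  have sn: "simple_function (p n) s" for n
    using s(1) by (simp add: simple_function_def sp p(2))
  have em: "emeasure (p n) A = ennreal (measure (p n) A)" for n A
    using p(1)[of n] by (simp add: finite_measure.emeasure_eq_measure prob_space_def)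
  have "(\<lambda>n. integral\<^sup>S (p n) s) \<longlonglongrightarrow> integral\<^sup>S \<pi> s"
    unfolding simple_integral_def sp em \<pi>.emeasure_eq_measure
    using s simple_functionD[OF s(1)]
    by (intro tendsto_sum ennreal_tendsto_cmult tendsto_ennrealI conv) auto
  moreover have "integral\<^sup>S (p n) s \<le> b n" for n
  proof -
    have "integral\<^sup>S (p n) s = (\<integral>\<^sup>+x. s x \<partial>p n)" by (rule nn_integral_eq_simple_integral[OF sn, symmetric])
    also have "\<dots> \<le> (\<integral>\<^sup>+x. f x \<partial>p n)" using s(2) by (intro nn_integral_mono) (simp add: le_fun_def)
    finally show ?thesis using bound order_trans by blast
  qed
  ultimately show "integral\<^sup>S \<pi> s \<le> B" using b by (intro LIMSEQ_le[of _ _ b]) auto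
qed

lemma bounded_integrable:
  fixes f :: "'a::topological_space \<Rightarrow> real"
  assumes "prob_space L" and [measurable_cong]: "sets L = sets borel" and [measurable]: "f \<in> borel_measurable borel" and "\<And>x. \<bar>f x\<bar> \<le> B"
  shows "integrable L f" "\<bar>\<integral>x. f x \<partial>L\<bar> \<le> B"
proof -
  interpret prob_space L by fact
  show int: "integrable L f" using assms(4) by (intro integrable_const_bound[of _ B]) auto
  have "\<bar>\<integral>x. f x \<partial>L\<bar> \<le> (\<integral>x. \<bar>f x\<bar> \<partial>L)" by (rule integral_abs_bound)
  also have "\<dots> \<le> (\<integral>x. B \<partial>L)" using int assms(4) by (intro integral_mono) auto
  finally show "\<bar>\<integral>x. f x \<partial>L\<bar> \<le> B" by (simp add: prob_space)
qed

lemma integral_measurable: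
  fixes f :: "'a::topological_space \<Rightarrow> real"
  assumes "J \<in> borel \<rightarrow>\<^sub>M prob_algebra (borel :: 'a measure)" "f \<in> borel_measurable borel"
  shows "(\<lambda>x. \<integral>y. f y \<partial>J x) \<in> borel_measurable borel"
  by (rule measurable_compose[OF measurable_prob_algebraD[OF assms(1)] integral_measurable_subprob_algebra[OF assms(2)]])

lemma integral_bind_bounded:
  fixes f :: "'a::topological_space \<Rightarrow> real"
  assumes "prob_space L" "sets L = sets borel" and J: "J \<in> borel \<rightarrow>\<^sub>M prob_algebra (borel :: 'a measure)"
    and f: "f \<in> borel_measurable borel" "\<And>x. \<bar>f x\<bar> \<le> B"
  shows "(\<integral>y. f y \<partial>(L \<bind> J)) = (\<integral>x. (\<integral>y. f y \<partial>J x) \<partial>L)"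
proof (rule integral_bind[where K=borel and B=B and B'=1])
  have "space L = UNIV" using sets_eq_imp_space_eq[OF assms(2)] by simp
  show "J \<in> L \<rightarrow>\<^sub>M subprob_algebra borel"
    using measurable_prob_algebraD[OF J] assms(2) by (simp cong: measurable_cong_sets)
  show "finite_measure L" using assms(1) by (simp add: prob_space_def)
  show "AE x in L. emeasure (J x) (space (J x)) \<le> ennreal 1"
    using borel_kernelD(1)[OF J] by (simp add: prob_space.emeasure_space_1)
qed (use f in auto)

text \<open>The minorization constant is the mass of \<nu>. The condition on R makes
  \<open>l * S + 2 * b < S\<close> for every \<open>S = V x + V y\<close> with S at least R; for
  smaller sums both points lie in the small set, as V is nonnegative.\<close>

locale harris =
  fixes K :: "'a::topological_space \<Rightarrow> 'a measure" and V :: "'a \<Rightarrow> real" and l b R :: real and \<nu> :: "'a measure"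
  assumes kernel [measurable]: "K \<in> borel \<rightarrow>\<^sub>M prob_algebra borel"
    and V_measurable [measurable]: "V \<in> borel_measurable borel"
    and V_nonneg: "\<And>x. 0 \<le> V x"
    and l: "0 \<le> l" "l < 1" and b: "0 \<le> b"
    and V_integrable: "\<And>x. integrable (K x) V"
    and drift: "\<And>x. (\<integral>y. V y \<partial>K x) \<le> l * V x + b"
    and R: "2 * b < (1 - l) * R"
    and \<nu>_subprob: "subprob_space \<nu>" and \<nu>_sets [simp, measurable_cong]: "sets \<nu> = sets borel"
    and \<nu>_pos: "0 < measure \<nu> UNIV"
    and minorization: "\<And>x A. V x \<le> R \<Longrightarrow> A \<in> sets borel \<Longrightarrow> emeasure \<nu> A \<le> emeasure (K x) A"
begin

sublocale \<nu>: subprob_space \<nu> by (rule \<nu>_subprob)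

definition eps :: real where "eps = measure \<nu> UNIV"
text \<open>Chosen so that the drift costs at most \<open>2 * \<beta> * b \<le> eps\<close>, half of
  the gain \<open>2 * eps\<close> from minorization. The 1 avoids division by zero if b = 0.\<close>

definition \<beta> :: real where "\<beta> = eps / (2 * (b + 1))"
text \<open>The last entry is the contraction ratio at \<open>V x + V y = R\<close>, the worst case
  far out; \<open>1 - eps / 2\<close> is the ratio of the constant terms near the origin, and l that
  of the terms in V.\<close>

definition \<alpha> :: real where
  "\<alpha> = max (max l (1 - eps / 2)) ((2 + \<beta> * (2 * b + l * R)) / (2 + \<beta> * R))"

text \<open>Hairer and Mattingly's weighted distance, except on the diagonal, where it is not set to
  0; as a bound for \<open>f x - f y\<close> it is trivially valid there.\<close>

abbreviation d :: "'a \<Rightarrow> 'a \<Rightarrow> real" where "d x y \<equiv> 2 + \<beta> * V x + \<beta> * V y"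

abbreviation KI :: "('a \<Rightarrow> real) \<Rightarrow> 'a \<Rightarrow> real" where "KI f x \<equiv> (\<integral>y. f y \<partial>K x)"

lemmas K_props = borel_kernelD[OF kernel]
lemmas pow_measurable = kernel_pow_measurable[OF kernel]
lemmas pow_props = borel_kernelD[OF pow_measurable]

lemma sets_K [simp, measurable_cong]: "sets (K x) = sets borel" by (rule K_props)
lemma sets_pow [simp, measurable_cong]: "sets (kernel_pow K n x) = sets borel" by (rule pow_props)

lemma eps: "0 < eps" "eps \<le> 1"
  using \<nu>_pos \<nu>.subprob_measure_le_1 by (simp_all add: eps_def)

lemma R_nonneg: "0 \<le> R"
  using R b l by (smt (verit) mult_nonneg_nonpos)

lemma \<beta>: "0 < \<beta>" "2 * \<beta> * b \<le> eps"
  using eps b by (simp_all add: \<beta>_def field_simps)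

lemma \<alpha>: "0 < \<alpha>" "\<alpha> < 1" "l \<le> \<alpha>" "1 - eps / 2 \<le> \<alpha>"
proof -
  have "0 < 2 + \<beta> * R" using \<beta> R_nonneg by (simp add: add_pos_nonneg)
  moreover have "\<beta> * (2 * b + l * R) < \<beta> * R"
    using \<beta> R by (intro mult_strict_left_mono) (auto simp: algebra_simps)
  ultimately show "\<alpha> < 1" using l eps by (simp add: \<alpha>_def)
  have "1 - eps / 2 > 0" using eps by simp
  then show "0 < \<alpha>" unfolding \<alpha>_def by linarith
  show "l \<le> \<alpha>" "1 - eps / 2 \<le> \<alpha>" by (simp_all add: \<alpha>_def)
qed

text \<open>At \<open>V x + V y = R\<close> this is the last entry of \<alpha>; beyond, the left
  side grows with slope \<open>\<beta> * l\<close>, the right side with slope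
  \<open>\<beta> * \<alpha>\<close>.\<close>

lemma outside_bound:
  assumes "R \<le> V x + V y"
  shows "2 + \<beta> * (l * V x + b) + \<beta> * (l * V y + b) \<le> \<alpha> * d x y"
proof -
  define S where "S = V x + V y"
  have pos: "0 < 2 + \<beta> * R" using \<beta> R_nonneg by (simp add: add_pos_nonneg)
  have "2 + \<beta> * (2 * b + l * R) \<le> \<alpha> * (2 + \<beta> * R)"
    using pos by (simp add: \<alpha>_def pos_divide_le_eq[symmetric])
  moreover have "l * (\<beta> * (S - R)) \<le> \<alpha> * (\<beta> * (S - R))"
    using \<alpha> \<beta> assms by (intro mult_right_mono) (auto simp: S_def)
  ultimately have "2 + \<beta> * (2 * b + l * S) \<le> \<alpha> * (2 + \<beta> * S)"
    by (simp add: algebra_simps)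
  then show ?thesis by (simp add: S_def algebra_simps)
qed

text \<open>The constants are at most \<open>2 + eps - 2 * eps = 2 * (1 - eps / 2)\<close>, and the
  terms in V carry the factor l.\<close>

lemma inside_bound:
  "2 + \<beta> * (l * V x + b) + \<beta> * (l * V y + b) - 2 * eps \<le> \<alpha> * d x y"
proof -
  have "l * (\<beta> * (V x + V y)) \<le> \<alpha> * (\<beta> * (V x + V y))"
    using \<alpha> \<beta> V_nonneg by (intro mult_right_mono) auto
  then show ?thesis using \<alpha>(4) \<beta>(2) by (simp add: algebra_simps)
qed

lemma \<nu>_integral_le:
  assumes "V x \<le> R" and [measurable]: "g \<in> borel_measurable borel"
    and "\<And>z. 0 \<le> g z" "integrable (K x) g"
  shows "integrable \<nu> g" "(\<integral>z. g z \<partial>\<nu>) \<le> KI g x"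
proof -
  have "\<nu> \<le> K x" using minorization[OF assms(1)] by (subst le_measure) auto
  then have le: "(\<integral>\<^sup>+z. ennreal (g z) \<partial>\<nu>) \<le> (\<integral>\<^sup>+z. ennreal (g z) \<partial>K x)"
    by (intro nn_integral_mono_measure) auto
  have eq: "(\<integral>\<^sup>+z. ennreal (g z) \<partial>K x) = ennreal (KI g x)"
    using assms by (intro nn_integral_eq_integral) auto
  show int: "integrable \<nu> g"
    using le assms unfolding eq by (intro integrableI_nonneg) (auto simp: le_less_trans)
  then have "(\<integral>\<^sup>+z. ennreal (g z) \<partial>\<nu>) = ennreal (\<integral>z. g z \<partial>\<nu>)"
    using assms by (intro nn_integral_eq_integral) auto
  with le eq show "(\<integral>z. g z \<partial>\<nu>) \<le> KI g x"
    using assms(3) by (simp add: ennreal_le_iff integral_nonneg)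
qed

text \<open>The Hairer--Mattingly argument: after subtracting a constant c, the function f is bounded
  by a multiple of 1 + \<beta> V.\<close>

lemma contraction:
  assumes [measurable]: "f \<in> borel_measurable borel" and bd: "\<And>x. \<bar>f x\<bar> \<le> B"
    and f: "\<And>x y. f x - f y \<le> a * d x y" and a: "0 \<le> a"
  shows "KI f x - KI f y \<le> a * \<alpha> * d x y"
proof -
  define w where "w z = a * (1 + \<beta> * V z)" for z
  \<comment> \<open>The hypothesis on f says that every value of \<open>f - w\<close> lies below
    every value of \<open>f + w\<close>; any c in between satisfies
    \<open>\<bar>f z - c\<bar> \<le> w z\<close>.\<close>
  define c where "c = (SUP z. f z - w z)"
  have le: "f z - w z \<le> f y + w y" for z y
    using f[of z y] by (simp add: w_def algebra_simps)
  have "bdd_above (range (\<lambda>z. f z - w z))" using le by (auto intro!: bdd_aboveI)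
  then have up: "f z - w z \<le> c" for z unfolding c_def by (rule cSUP_upper[OF UNIV_I])
  have lo: "c \<le> f z + w z" for z unfolding c_def using le by (intro cSUP_least) auto
  define g1 where "g1 z = w z - (f z - c)" for z
  define g2 where "g2 z = w z + (f z - c)" for z
  have [measurable]: "w \<in> borel_measurable borel" "g1 \<in> borel_measurable borel" "g2 \<in> borel_measurable borel"
    unfolding w_def g1_def g2_def by measurable
  have g: "0 \<le> g1 z" "0 \<le> g2 z" for z using up[of z] lo[of z] by (auto simp: g1_def g2_def)
  have f_int: "integrable (K x) f" for x
    using K_props(1)[of x] bd by (intro finite_measure.integrable_const_bound[of _ _ B]) (auto simp: prob_space_def)
  have const: "integrable (K x) (\<lambda>_. r)" "KI (\<lambda>_. r) x = r" for x and r :: real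
    using K_props(1)[of x] by (auto simp: prob_space.prob_space prob_space_def finite_measure.integrable_const)
  have w_int: "integrable (K x) w" and w_le: "KI w x \<le> a * (1 + \<beta> * (l * V x + b))" for x
  proof -
    show "integrable (K x) w" unfolding w_def using V_integrable const by auto
    have "KI w x = a * (1 + \<beta> * KI V x)" unfolding w_def using V_integrable const by simp
    then show "KI w x \<le> a * (1 + \<beta> * (l * V x + b))"
      using drift a \<beta> by (auto intro!: mult_left_mono)
  qed
  have g_int: "integrable (K x) g1" "integrable (K x) g2"
    and g_eq: "KI g1 x = KI w x - KI f x + c" "KI g2 x = KI w x + KI f x - c" for x
    unfolding g1_def g2_def using f_int w_int const by (auto simp: prob_space.prob_space[OF K_props(1)])
  \<comment> \<open>The constant c cancels; g1 and g2 are the slack in the two bounds on f -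
    c.\<close>
  have sum: "KI f x - KI f y = KI w x + KI w y - (KI g1 x + KI g2 y)" by (simp add: g_eq)
  have ws: "KI w x + KI w y \<le> a * (2 + \<beta> * (l * V x + b) + \<beta> * (l * V y + b))"
    using w_le[of x] w_le[of y] by (simp add: algebra_simps)
  show ?thesis
  proof (cases "R \<le> V x + V y")
    case True
    have "0 \<le> KI g1 x" "0 \<le> KI g2 y" using g by (auto intro: integral_nonneg)
    then have "KI f x - KI f y \<le> a * (2 + \<beta> * (l * V x + b) + \<beta> * (l * V y + b))" using sum ws by linarith
    also have "\<dots> \<le> a * (\<alpha> * d x y)" using outside_bound[OF True] a by (rule mult_left_mono)
    finally show ?thesis by (simp add: mult.assoc)
  next
    case False
    then have xy: "V x \<le> R" "V y \<le> R" using V_nonneg[of x] V_nonneg[of y] by linarith+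
    note n1 = \<nu>_integral_le[OF xy(1) _ g(1) g_int(1)] and n2 = \<nu>_integral_le[OF xy(2) _ g(2) g_int(2)]
    \<comment> \<open>Both kernels dominate \<nu>, so the two slacks can be added at the same point
      z, where \<open>g1 z + g2 z = 2 * w z\<close> is at least 2 a.\<close>
    have "2 * a * eps = (\<integral>z. 2 * a \<partial>\<nu>)"
      using sets_eq_imp_space_eq[OF \<nu>_sets] by (simp add: eps_def)
    also have "\<dots> \<le> (\<integral>z. g1 z + g2 z \<partial>\<nu>)"
    proof (rule integral_mono)
      show "2 * a \<le> g1 z + g2 z" for z using a \<beta> V_nonneg by (simp add: g1_def g2_def w_def algebra_simps)
    qed (use n1 n2 in auto)
    also have "\<dots> = (\<integral>z. g1 z \<partial>\<nu>) + (\<integral>z. g2 z \<partial>\<nu>)" using n1 n2 by (intro Bochner_Integration.integral_add) auto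
    also have "\<dots> \<le> KI g1 x + KI g2 y" using n1 n2 by (intro add_mono) auto
    finally have "KI f x - KI f y \<le> a * (2 + \<beta> * (l * V x + b) + \<beta> * (l * V y + b) - 2 * eps)"
      using sum ws by (simp add: algebra_simps)
    also have "\<dots> \<le> a * (\<alpha> * d x y)" using inside_bound a by (rule mult_left_mono)
    finally show ?thesis by (simp add: mult.assoc)
  qed
qed

text \<open>The last step of the chain is moved onto the test function: \<open>KI f\<close>
  satisfies the hypotheses with \<open>a * \<alpha>\<close>, so the induction is general in f and
  a.\<close>

lemma pow_contraction:
  assumes "f \<in> borel_measurable borel" "\<And>x. \<bar>f x\<bar> \<le> B"
    and "\<And>x y. f x - f y \<le> a * d x y" "0 \<le> a"
  shows "(\<integral>z. f z \<partial>kernel_pow K n x) - (\<integral>z. f z \<partial>kernel_pow K n y) \<le> a * \<alpha> ^ n * d x y"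
  using assms
proof (induction n arbitrary: f a)
  case 0
  then show ?case by (simp add: integral_return)
next
  case (Suc n)
  have "(\<integral>z. KI f z \<partial>kernel_pow K n x) - (\<integral>z. KI f z \<partial>kernel_pow K n y) \<le> (a * \<alpha>) * \<alpha> ^ n * d x y"
  proof (rule Suc.IH)
    show "KI f \<in> borel_measurable borel" by (intro integral_measurable kernel Suc.prems)
    show "\<bar>KI f z\<bar> \<le> B" for z by (rule bounded_integrable(2)[OF K_props(1,2) Suc.prems(1,2)])
    show "KI f x - KI f y \<le> a * \<alpha> * d x y" for x y by (rule contraction[OF Suc.prems])
    show "0 \<le> a * \<alpha>" using \<alpha> Suc.prems by simp
  qed
  then show ?case
    using Suc.prems by (simp add: integral_bind_bounded[OF pow_props(1) pow_props(2) kernel Suc.prems(1,2)] mult_ac)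
qed

section \<open>Moments, existence and uniqueness of the invariant law\<close>

text \<open>\<open>b / (1 - l)\<close> is the fixed point of the drift map
  \<open>\<lambda>v. l * v + b\<close>. Extended nonnegative integrals avoid a prior proof of
  integrability.\<close>

lemma pow_moment: "(\<integral>\<^sup>+y. V y \<partial>kernel_pow K n x) \<le> ennreal (V x + b / (1 - l))"
proof (induction n)
  case 0
  then show ?case using b l by (simp add: nn_integral_return ennreal_leI)
next
  case (Suc n)
  have K_V: "(\<integral>\<^sup>+z. V z \<partial>K y) \<le> ennreal (l * V y + b)" for y
    using drift[of y] V_nonneg V_integrable by (subst nn_integral_eq_integral) (auto intro: ennreal_leI)
  have "(\<integral>\<^sup>+y. V y \<partial>kernel_pow K (Suc n) x) = (\<integral>\<^sup>+y. (\<integral>\<^sup>+z. V z \<partial>K y) \<partial>kernel_pow K n x)"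
    unfolding kernel_pow.simps
    by (rule nn_integral_bind[where B=borel])
       (use measurable_prob_algebraD[OF kernel] in \<open>simp_all cong: measurable_cong_sets\<close>)
  also have "\<dots> \<le> (\<integral>\<^sup>+y. ennreal l * ennreal (V y) + ennreal b \<partial>kernel_pow K n x)"
    using K_V l b V_nonneg by (intro nn_integral_mono) (simp add: ennreal_plus ennreal_mult)
  also have "\<dots> = ennreal l * (\<integral>\<^sup>+y. V y \<partial>kernel_pow K n x) + ennreal b"
    using pow_props(1)[of n x] by (subst nn_integral_add) (auto simp: nn_integral_cmult prob_space.emeasure_space_1)
  also have "\<dots> \<le> ennreal l * ennreal (V x + b / (1 - l)) + ennreal b"
    using Suc by (intro add_mono mult_left_mono) auto
  also have "\<dots> = ennreal (l * (V x + b / (1 - l)) + b)"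
    using l b V_nonneg by (simp add: ennreal_plus ennreal_mult)
  also have "\<dots> \<le> ennreal (V x + b / (1 - l))"
  proof (rule ennreal_leI)
    have "l * V x \<le> V x" using l V_nonneg[of x] by (simp add: mult_left_le_one_le)
    moreover have "l * (b / (1 - l)) + b = b / (1 - l)" using l by (simp add: field_simps)
    ultimately show "l * (V x + b / (1 - l)) + b \<le> V x + b / (1 - l)" by (simp add: distrib_left)
  qed
  finally show ?case .
qed

text \<open>The contraction, averaged over a random second starting point with law L. Taking a law
  of the chain for L gives the Cauchy estimate; taking the invariant law gives the rate.\<close>

lemma average_bound:
  assumes f: "f \<in> borel_measurable borel" "\<And>x. \<bar>f x\<bar> \<le> 1"
    and L: "prob_space L" and sets_L [simp, measurable_cong]: "sets L = sets borel"
    and C: "(\<integral>\<^sup>+y. V y \<partial>L) \<le> ennreal C" "0 \<le> C"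
  shows "\<bar>(\<integral>z. f z \<partial>kernel_pow K n x) - (\<integral>z. f z \<partial>(L \<bind> kernel_pow K n))\<bar> \<le> \<alpha> ^ n * (2 + \<beta> * V x + \<beta> * C)"
proof -
  interpret prob_space L by (rule L)
  let ?g = "\<lambda>y. \<integral>z. f z \<partial>kernel_pow K n y"
  have g_meas [measurable]: "?g \<in> borel_measurable borel"
    by (intro integral_measurable pow_measurable f)
  have g_bd: "\<bar>?g y\<bar> \<le> 1" for y by (rule bounded_integrable(2)[OF pow_props(1,2) f])
  have g_int: "integrable L ?g" by (rule bounded_integrable(1)[OF L sets_L g_meas g_bd])
  have f_d: "f y - f z \<le> 1 * d y z" for y z
  proof -
    have "0 \<le> \<beta> * V y" "0 \<le> \<beta> * V z" using \<beta> V_nonneg by auto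
    then show ?thesis using f(2)[of y] f(2)[of z] by (simp add: abs_le_iff)
  qed
  have diff: "\<bar>?g x - ?g y\<bar> \<le> \<alpha> ^ n * d x y" for y
    using pow_contraction[OF f f_d, of n x y] pow_contraction[OF f f_d, of n y x]
    by (simp add: abs_le_iff algebra_simps)
  have V_int: "integrable L V"
    using C V_nonneg by (intro integrableI_nonneg) (auto simp: le_less_trans)
  have "ennreal (\<integral>y. V y \<partial>L) \<le> ennreal C"
    using C V_nonneg V_int by (subst nn_integral_eq_integral[symmetric]) auto
  then have V_le: "(\<integral>y. V y \<partial>L) \<le> C" using C by (simp add: ennreal_le_iff)
  have "?g x - (\<integral>z. f z \<partial>(L \<bind> kernel_pow K n)) = (\<integral>y. ?g x - ?g y \<partial>L)"
    using g_int by (simp add: integral_bind_bounded[OF L sets_L pow_measurable f] prob_space)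
  then have "\<bar>?g x - (\<integral>z. f z \<partial>(L \<bind> kernel_pow K n))\<bar> \<le> (\<integral>y. \<bar>?g x - ?g y\<bar> \<partial>L)"
    by (simp only: integral_abs_bound)
  also have "\<dots> \<le> (\<integral>y. \<alpha> ^ n * d x y \<partial>L)"
    using g_int V_int diff by (intro integral_mono) auto
  also have "\<dots> = \<alpha> ^ n * (2 + \<beta> * V x + \<beta> * (\<integral>y. V y \<partial>L))"
    using V_int by (simp add: prob_space)
  also have "\<dots> \<le> \<alpha> ^ n * (2 + \<beta> * V x + \<beta> * C)"
    using V_le \<alpha> \<beta> by (intro mult_left_mono add_left_mono) auto
  finally show ?thesis .
qed

lemma invariant_bind:
  assumes "invariant_prob K \<pi>"
  shows "\<pi> \<bind> kernel_pow K n = \<pi>"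
proof (induction n)
  case 0
  have "kernel_pow K 0 = return borel" by (rule ext) simp
  then show ?case using assms by (simp add: invariant_prob_def bind_return'')
next
  case (Suc n)
  have \<pi>: "prob_space \<pi>" and \<pi>s [measurable_cong]: "sets \<pi> = sets borel" using assms by (auto simp: invariant_prob_def)
  have [simp]: "space \<pi> = UNIV" using sets_eq_imp_space_eq[OF \<pi>s] by simp
  have "\<pi> \<bind> kernel_pow K (Suc n) = (\<pi> \<bind> kernel_pow K n) \<bind> K"
    unfolding kernel_pow.simps
    by (subst bind_assoc[where N=borel and R=borel])
       (use measurable_prob_algebraD[OF kernel] measurable_prob_algebraD[OF pow_measurable] \<pi>s in \<open>simp_all cong: measurable_cong_sets\<close>)
  also have "\<dots> = \<pi> \<bind> K" by (simp add: Suc)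
  also have "\<dots> = \<pi>"
  proof (rule measure_eqI)
    show "sets (\<pi> \<bind> K) = sets \<pi>" using \<pi>s by simp
    fix A assume "A \<in> sets (\<pi> \<bind> K)"
    then have A: "A \<in> sets borel" by simp
    then have "emeasure (\<pi> \<bind> K) A = (\<integral>\<^sup>+x. emeasure (K x) A \<partial>\<pi>)"
      using measurable_prob_algebraD[OF kernel] \<pi>s by (intro emeasure_bind[where N=borel]) (simp_all cong: measurable_cong_sets)
    then show "emeasure (\<pi> \<bind> K) A = emeasure \<pi> A"
      using assms A by (simp add: invariant_prob_def)
  qed
  finally show ?case .
qed

text \<open>The limit law is invariant because Fatou gives one inequality on every Borel set and
  complements give the other. The moment bound is kept for the later use of
  \<open>average_bound\<close>.\<close>

lemma exists_invariant:
  obtains \<pi> C where "invariant_prob K \<pi>" "0 \<le> C" "(\<integral>\<^sup>+y. V y \<partial>\<pi>) \<le> ennreal C"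
proof -
  fix x0 :: 'a
  define C where "C = V x0 + b / (1 - l)"
  have C: "0 \<le> C" using V_nonneg b l by (simp add: C_def)
  let ?p = "\<lambda>n. kernel_pow K n x0"
  have "\<bar>measure (?p n) A - measure (?p m) A\<bar> \<le> \<alpha> ^ n * (2 + \<beta> * V x0 + \<beta> * C)"
    if "n \<le> m" "A \<in> sets borel" for n m A
  proof -
    \<comment> \<open>The first m - n steps serve as a random starting point, so that exactly n
      steps remain to contract.\<close>
    have split: "?p m = ?p (m - n) \<bind> kernel_pow K n"
      using kernel_pow_add[OF kernel, of "m - n" n x0] that by simp
    then show ?thesis
      using average_bound[of "indicator A" "?p (m - n)" C n x0] pow_props(1) pow_moment[of "m - n" x0] C that
      by (simp add: C_def[symmetric] split[symmetric] pow_props(3))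
  qed
  moreover have "(\<lambda>n. \<alpha> ^ n * (2 + \<beta> * V x0 + \<beta> * C)) \<longlonglongrightarrow> 0"
    using \<alpha> by (intro tendsto_mult_left_zero LIMSEQ_realpow_zero) auto
  ultimately obtain \<pi> where \<pi>: "prob_space \<pi>" "sets \<pi> = sets borel"
    and conv: "\<And>A. A \<in> sets borel \<Longrightarrow> (\<lambda>n. measure (?p n) A) \<longlonglongrightarrow> measure \<pi> A"
    using setwise_limit_measure[of ?p borel "\<lambda>n. \<alpha> ^ n * (2 + \<beta> * V x0 + \<beta> * C)"] pow_props(1,2) by metis
  interpret \<pi>: prob_space \<pi> by fact
  note [measurable_cong] = \<pi>(2)
  have [simp]: "space \<pi> = UNIV" using sets_eq_imp_space_eq[OF \<pi>(2)] by simp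
  have fatou: "(\<integral>\<^sup>+x. f x \<partial>\<pi>) \<le> B" if "\<And>n. (\<integral>\<^sup>+x. f x \<partial>?p n) \<le> u n" "u \<longlonglongrightarrow> B" for f u B
    using \<pi> conv that pow_props(1) by (intro nn_integral_setwise_liminf[of ?p \<pi> f u B]) auto
  have V: "(\<integral>\<^sup>+y. V y \<partial>\<pi>) \<le> ennreal C"
    using pow_moment by (intro fatou[of _ "\<lambda>_. ennreal C"]) (auto simp: C_def)
  have em_bind: "emeasure (L \<bind> K) A = (\<integral>\<^sup>+x. emeasure (K x) A \<partial>L)"
    if "A \<in> sets borel" and L: "sets L = sets borel" for L A
    using measurable_prob_algebraD[OF kernel] sets_eq_imp_space_eq[OF L] that
    by (intro emeasure_bind[where N=borel]) (simp_all cong: measurable_cong_sets)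
  have prob_q: "prob_space (\<pi> \<bind> K)"
    using measurable_prob_algebraD[OF kernel] K_props(1) by (intro \<pi>.prob_space_bind[where S=borel]) auto
  interpret q: prob_space "\<pi> \<bind> K" by (rule prob_q)
  have sets_q: "sets (\<pi> \<bind> K) = sets borel" by simp
  have le: "measure (\<pi> \<bind> K) A \<le> measure \<pi> A" if A: "A \<in> sets borel" for A
  proof -
    have "emeasure (\<pi> \<bind> K) A \<le> ennreal (measure \<pi> A)"
      unfolding em_bind[OF A \<pi>(2)]
    proof (rule fatou)
      show "(\<integral>\<^sup>+x. emeasure (K x) A \<partial>?p n) \<le> ennreal (measure (?p (Suc n)) A)" for n
        using em_bind[OF A sets_pow] prob_space.finite_measure[OF pow_props(1)[of "Suc n" x0]]
        by (simp add: finite_measure.emeasure_eq_measure[symmetric])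
      show "(\<lambda>n. ennreal (measure (?p (Suc n)) A)) \<longlonglongrightarrow> ennreal (measure \<pi> A)"
        by (intro tendsto_ennrealI LIMSEQ_Suc conv A)
    qed
    then show ?thesis by (simp add: q.emeasure_eq_measure)
  qed
  have eq: "measure (\<pi> \<bind> K) A = measure \<pi> A" if A: "A \<in> sets borel" for A
  proof -
    have "1 - measure (\<pi> \<bind> K) A \<le> 1 - measure \<pi> A"
      using le[of "- A"] A q.prob_compl[of A] \<pi>.prob_compl[of A] \<pi>(2) sets_q sets_eq_imp_space_eq[OF sets_q]
      by (simp add: Compl_eq_Diff_UNIV)
    then show ?thesis using le[OF A] by simp
  qed
  have "invariant_prob K \<pi>"
    using \<pi> eq by (auto simp: invariant_prob_def em_bind[symmetric] q.emeasure_eq_measure \<pi>.emeasure_eq_measure)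
  then show ?thesis using that C V by blast
qed

theorem geometric_ergodicity:
  "\<exists>\<pi>. invariant_prob K \<pi> \<and> (\<forall>\<pi>'. invariant_prob K \<pi>' \<longrightarrow> \<pi>' = \<pi>) \<and>
     (\<exists>\<gamma> C. 0 < \<gamma> \<and> \<gamma> < 1 \<and> C > 0 \<and>
       (\<forall>n x f. f \<in> borel_measurable borel \<longrightarrow> (\<forall>z. \<bar>f z\<bar> \<le> 1) \<longrightarrow>
         \<bar>(\<integral>z. f z \<partial>kernel_pow K n x) - (\<integral>z. f z \<partial>\<pi>)\<bar> \<le> C * \<gamma> ^ n * (1 + V x)))"
proof -
  obtain \<pi> C where inv: "invariant_prob K \<pi>" and C: "0 \<le> C" "(\<integral>\<^sup>+y. V y \<partial>\<pi>) \<le> ennreal C"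
    by (rule exists_invariant)
  have \<pi>: "prob_space \<pi>" "sets \<pi> = sets borel" using inv by (auto simp: invariant_prob_def)
  \<comment> \<open>Large enough for
    \<open>2 + \<beta> * V x + \<beta> * C \<le> D * (1 + V x)\<close>.\<close>
  define D where "D = 2 + \<beta> + \<beta> * C"
  have D: "0 < D" using \<beta> C by (simp add: D_def add_pos_nonneg)
  have bound: "\<bar>(\<integral>z. f z \<partial>kernel_pow K n x) - (\<integral>z. f z \<partial>\<pi>)\<bar> \<le> D * \<alpha> ^ n * (1 + V x)"
    if f: "f \<in> borel_measurable borel" "\<And>z. \<bar>f z\<bar> \<le> 1" for f n x
  proof -
    have "\<bar>(\<integral>z. f z \<partial>kernel_pow K n x) - (\<integral>z. f z \<partial>\<pi>)\<bar> \<le> \<alpha> ^ n * (2 + \<beta> * V x + \<beta> * C)"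
      using average_bound[OF f \<pi> C(2,1)] invariant_bind[OF inv] by simp
    also have "\<dots> \<le> \<alpha> ^ n * (D * (1 + V x))"
    proof (rule mult_left_mono)
      have "0 \<le> 2 * V x" "0 \<le> \<beta> * C * V x" using \<beta> C V_nonneg by auto
      then show "2 + \<beta> * V x + \<beta> * C \<le> D * (1 + V x)" using \<beta> by (simp add: D_def algebra_simps)
    qed (use \<alpha> in simp)
    finally show ?thesis by (simp add: mult_ac)
  qed
  have "\<pi>' = \<pi>" if inv': "invariant_prob K \<pi>'" for \<pi>'
  proof (rule measure_eqI)
    have \<pi>': "prob_space \<pi>'" "sets \<pi>' = sets borel" using inv' by (auto simp: invariant_prob_def)
    interpret \<pi>': prob_space \<pi>' by (rule \<pi>')
    interpret \<pi>: prob_space \<pi> by (rule \<pi>)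
    show "sets \<pi>' = sets \<pi>" using \<pi> \<pi>' by simp
    fix A assume "A \<in> sets \<pi>'"
    then have A: "A \<in> sets borel" using \<pi>' by simp
    let ?f = "indicat_real A"
    let ?g = "\<lambda>n x. \<integral>z. ?f z \<partial>kernel_pow K n x"
    have f: "?f \<in> borel_measurable borel" "\<bar>?f z\<bar> \<le> 1" for z using A by auto
    have g_meas: "?g n \<in> borel_measurable borel" for n
      by (rule integral_measurable[OF pow_measurable f(1)])
    have "(\<lambda>n. \<integral>x. ?g n x \<partial>\<pi>') \<longlonglongrightarrow> (\<integral>x. (\<integral>z. ?f z \<partial>\<pi>) \<partial>\<pi>')"
    proof (rule integral_dominated_convergence[where w="\<lambda>_. 1"])
      show "AE x in \<pi>'. norm (?g n x) \<le> 1" for n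
        using bounded_integrable(2)[OF pow_props(1,2) f, of n] by simp
      have "(\<lambda>n. ?g n x) \<longlonglongrightarrow> (\<integral>z. ?f z \<partial>\<pi>)" for x
      proof (rule Lim_transform_bound[where g="\<lambda>n. D * \<alpha> ^ n * (1 + V x)", THEN LIM_zero_cancel])
        show "(\<lambda>n. D * \<alpha> ^ n * (1 + V x)) \<longlonglongrightarrow> 0"
          using \<alpha> by (intro tendsto_mult_left_zero tendsto_mult_right_zero LIMSEQ_realpow_zero) auto
        show "\<forall>\<^sub>F n in sequentially. norm (?g n x - (\<integral>z. ?f z \<partial>\<pi>)) \<le> norm (D * \<alpha> ^ n * (1 + V x))"
          using bound[OF f] by (intro always_eventually allI) (simp add: order_trans[OF _ abs_ge_self])
      qed
      then show "AE x in \<pi>'. (\<lambda>n. ?g n x) \<longlonglongrightarrow> (\<integral>z. ?f z \<partial>\<pi>)" by simp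
    qed (use g_meas \<pi>' in \<open>simp_all cong: measurable_cong_sets\<close>)
    moreover have "(\<integral>x. ?g n x \<partial>\<pi>') = (\<integral>z. ?f z \<partial>\<pi>')" for n
      using integral_bind_bounded[OF \<pi>' pow_measurable f, of n] invariant_bind[OF inv', of n] by simp
    ultimately have "(\<integral>z. ?f z \<partial>\<pi>') = (\<integral>z. ?f z \<partial>\<pi>)"
      by (simp add: LIMSEQ_const_iff \<pi>'.prob_space)
    then show "emeasure \<pi>' A = emeasure \<pi> A"
      using A \<pi>(2) \<pi>'(2) by (simp add: \<pi>.emeasure_eq_measure \<pi>'.emeasure_eq_measure sets_eq_imp_space_eq[OF \<pi>(2)] sets_eq_imp_space_eq[OF \<pi>'(2)])
  qed
  then show ?thesis using inv bound D \<alpha>(1,2) by blast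
qed

end

section \<open>The autoregressive chain\<close>

context centered_gaussian
begin

text \<open>The Cameron--Martin density in the worst case over \<open>norm m \<le> r\<close>,
  estimating \<open>z \<bullet> m\<close> and \<open>Q m \<bullet> m\<close> separately.\<close>

abbreviation shift_minorizer :: "real \<Rightarrow> 'h measure" where
  "shift_minorizer r \<equiv> density \<mu> (\<lambda>z. ennreal (exp (- (r * norm z) - onorm Q * r\<^sup>2 / 2)))"

lemma shift_minorizer_le:
  assumes "bounded_linear Q" "norm m \<le> r"
  shows "shift_minorizer r \<le> distr \<mu> borel (\<lambda>z. Q m + z)"
proof -
  have "exp (- (r * norm z) - onorm Q * r\<^sup>2 / 2) \<le> exp (z \<bullet> m - (Q m \<bullet> m) / 2)" for z
  proof -
    have "- (z \<bullet> m) \<le> norm z * norm m" using norm_cauchy_schwarz[of "- z" m] by simp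
    also have "\<dots> \<le> r * norm z" using assms(2) by (subst mult.commute) (intro mult_right_mono, auto)
    finally have 1: "- (z \<bullet> m) \<le> r * norm z" .
    have "Q m \<bullet> m \<le> norm (Q m) * norm m" by (rule norm_cauchy_schwarz)
    also have "\<dots> \<le> (onorm Q * norm m) * norm m" by (intro mult_right_mono onorm assms) auto
    also have "\<dots> = onorm Q * (norm m)\<^sup>2" by (simp add: power2_eq_square)
    also have "\<dots> \<le> onorm Q * r\<^sup>2"
      using assms onorm_pos_le[OF assms(1)] by (intro mult_left_mono power_mono) auto
    finally show ?thesis using 1 by simp
  qed
  then show ?thesis
    unfolding cameron_martin
    by (subst le_measure) (auto simp: emeasure_density intro!: nn_integral_mono mult_right_mono ennreal_leI)
qed

lemma shift_minorizer_subprob: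
  assumes "bounded_linear Q" "0 \<le> r"
  shows "subprob_space (shift_minorizer r)"
proof (rule subprob_spaceI)
  have "- (r * norm z) - onorm Q * r\<^sup>2 / 2 \<le> 0" for z :: 'h
  proof -
    have "0 \<le> r * norm z" "0 \<le> onorm Q * r\<^sup>2"
      using onorm_pos_le[OF assms(1)] assms(2) by simp_all
    then show ?thesis by simp
  qed
  then have "emeasure (shift_minorizer r) UNIV \<le> (\<integral>\<^sup>+z. 1 \<partial>\<mu>)"
    by (auto simp: emeasure_density simp del: nn_integral_const intro!: nn_integral_mono)
  then show "emeasure (shift_minorizer r) (space (shift_minorizer r)) \<le> 1"
    using emeasure_space_1 by simp
qed simp

lemma shift_minorizer_pos:
  assumes "bounded_linear Q" "0 \<le> r"
  shows "0 < measure (shift_minorizer r) UNIV"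
proof -
  interpret S: subprob_space "shift_minorizer r" by (rule shift_minorizer_subprob[OF assms])
  have "emeasure (shift_minorizer r) UNIV \<noteq> 0"
  proof
    assume "emeasure (shift_minorizer r) UNIV = 0"
    \<comment> \<open>The density is strictly positive everywhere.\<close>
    then have "AE z in \<mu>. False" by (simp add: emeasure_density nn_integral_0_iff_AE)
    then show False by simp
  qed
  then show ?thesis by (simp add: S.emeasure_eq_measure zero_less_measure_iff)
qed

end

section \<open>From the recursion of paths to powers of a kernel\<close>

lemma (in prob_space) distr_indep_sum:
  fixes f :: "'h::{real_normed_vector, second_countable_topology} \<Rightarrow> 'h"
  assumes ind: "indep_var borel Y borel Z" and [measurable]: "f \<in> borel_measurable borel"
  shows "distr M borel (\<lambda>\<omega>. f (Y \<omega>) + Z \<omega>) =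
    distr M borel Y \<bind> (\<lambda>y. distr (distr M borel Z) borel (\<lambda>z. f y + z))"
proof (rule measure_eqI)
  let ?Y = "distr M borel Y" and ?K = "\<lambda>y. distr (distr M borel Z) borel (\<lambda>z. f y + z)"
  have [measurable]: "random_variable borel Y" "random_variable borel Z"
    using ind by (auto dest: indep_var_rv1 indep_var_rv2)
  interpret Z: prob_space "distr M borel Z" by (intro prob_space_distr) simp
  have K: "?K \<in> borel \<rightarrow>\<^sub>M subprob_algebra borel"
    by (intro measurable_prob_algebraD measurable_distr_prob_space2[where M=borel] measurable_const)
       (auto simp: space_prob_algebra Z.prob_space_axioms)
  fix A assume "A \<in> sets (distr M borel (\<lambda>\<omega>. f (Y \<omega>) + Z \<omega>))"
  then have [measurable]: "A \<in> sets borel" by simp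
  let ?S = "{p. f (fst p) + snd p \<in> A}"
  have S: "?S \<in> sets (borel \<Otimes>\<^sub>M borel)"
  proof -
    have "(\<lambda>p. f (fst p) + snd p) -` A \<inter> space (borel \<Otimes>\<^sub>M borel) \<in> sets (borel \<Otimes>\<^sub>M borel)" by measurable
    then show ?thesis by (simp add: vimage_def space_pair_measure)
  qed
  have "emeasure (distr M borel (\<lambda>\<omega>. f (Y \<omega>) + Z \<omega>)) A =
      emeasure (distr M (borel \<Otimes>\<^sub>M borel) (\<lambda>\<omega>. (Y \<omega>, Z \<omega>))) ?S"
    using S by (simp add: emeasure_distr vimage_def)
  also have "\<dots> = emeasure (?Y \<Otimes>\<^sub>M distr M borel Z) ?S"
    using ind by (simp add: indep_var_distribution_eq)
  also have "\<dots> = (\<integral>\<^sup>+y. emeasure (distr M borel Z) (Pair y -` ?S) \<partial>?Y)"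
    using S by (intro Z.emeasure_pair_measure_alt) simp
  also have "\<dots> = (\<integral>\<^sup>+y. emeasure (?K y) A \<partial>?Y)"
    by (intro nn_integral_cong) (simp add: emeasure_distr vimage_def)
  also have "\<dots> = emeasure (?Y \<bind> ?K) A"
    using K by (intro emeasure_bind[symmetric, where N=borel]) simp_all
  finally show "emeasure (distr M borel (\<lambda>\<omega>. f (Y \<omega>) + Z \<omega>)) A = emeasure (?Y \<bind> ?K) A" .
qed simp

text \<open>The path up to time t is measurable in \<open>F t\<close>, because it uses only earlier
  noise, and is therefore independent of \<open>\<xi> t\<close>; then \<open>distr_indep_sum\<close>
  appends one step.\<close>

lemma nfar_kernel_eq_kernel_pow:
  fixes \<xi> :: "nat \<Rightarrow> 'w \<Rightarrow> 'h::{real_normed_vector, second_countable_topology}"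
  assumes "prob_space M" and sub: "\<And>t. subalgebra M (F t)"
    and mono: "\<And>s t. s \<le> t \<Longrightarrow> sets (F s) \<subseteq> sets (F t)"
    and Psi [measurable]: "\<Psi> \<in> borel_measurable borel"
    and xi: "\<And>t. \<xi> t \<in> borel_measurable (F (Suc t))"
    and indep: "\<And>t. prob_space.indep_sets M
            (\<lambda>b. if b then sets (F t) else {\<xi> t -` A \<inter> space M | A. A \<in> sets borel}) UNIV"
    and ident: "\<And>t. distr M borel (\<xi> t) = \<mu>"
  shows "nfar_kernel M \<Psi> \<xi> t x = kernel_pow (\<lambda>y. distr \<mu> borel (\<lambda>z. \<Psi> y + z)) t x"
proof (induction t)
  interpret prob_space M by fact
  case 0
  have "nfar_path \<Psi> \<xi> x 0 = (\<lambda>_. x)" by (rule ext) simp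
  then show ?case by (simp add: nfar_kernel_def)
next
  interpret prob_space M by fact
  case (Suc t)
  have sp: "space (F s) = space M" for s using sub[of s] by (simp add: subalgebra_def)
  have path_Suc: "nfar_path \<Psi> \<xi> x (Suc t) = (\<lambda>\<omega>. \<Psi> (nfar_path \<Psi> \<xi> x t \<omega>) + \<xi> t \<omega>)" for t
    by (rule ext) simp
  have path: "nfar_path \<Psi> \<xi> x t \<in> borel_measurable (F t)" for t
  proof (induction t)
    case 0
    have "nfar_path \<Psi> \<xi> x 0 = (\<lambda>_. x)" by (rule ext) simp
    then show ?case by simp
  next
    case (Suc t)
    have "nfar_path \<Psi> \<xi> x t \<in> borel_measurable (F (Suc t))"
      using Suc mono[of t "Suc t"] by (auto intro: measurable_mono[THEN subsetD, rotated -1] simp: sp)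
    with xi[of t] have "(\<lambda>\<omega>. \<Psi> (nfar_path \<Psi> \<xi> x t \<omega>) + \<xi> t \<omega>) \<in> borel_measurable (F (Suc t))"
      by measurable
    then show ?case by (simp only: path_Suc)
  qed
  have rv: "random_variable borel (nfar_path \<Psi> \<xi> x t)" "random_variable borel (\<xi> t)"
    using measurable_from_subalg[OF sub path] measurable_from_subalg[OF sub xi] by auto
  have stable: "Int_stable {f -` A \<inter> space M | A. A \<in> sets borel}" for f :: "'w \<Rightarrow> 'h"
  proof (rule Int_stableI, clarify)
    fix A B :: "'h set" assume "A \<in> sets borel" "B \<in> sets borel"
    then show "\<exists>C. f -` A \<inter> space M \<inter> (f -` B \<inter> space M) = f -` C \<inter> space M \<and> C \<in> sets borel"
      by (intro exI[of _ "A \<inter> B"]) auto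
  qed
  have "indep_set (sets (F t)) {\<xi> t -` A \<inter> space M | A. A \<in> sets borel}"
    using indep[of t] unfolding indep_set_def
    by (rule indep_sets_mono_sets) (auto split: bool.split)
  then have "indep_set {nfar_path \<Psi> \<xi> x t -` A \<inter> space M | A. A \<in> sets borel} {\<xi> t -` A \<inter> space M | A. A \<in> sets borel}"
    unfolding indep_set_def
    by (rule indep_sets_mono_sets) (use measurable_sets[OF path[of t]] in \<open>auto simp: sp split: bool.split\<close>)
  then have "indep_var borel (nfar_path \<Psi> \<xi> x t) borel (\<xi> t)"
    using rv stable unfolding indep_var_eq by (auto intro!: indep_set_sigma_sets)
  from distr_indep_sum[OF this Psi] show ?case
    using Suc by (simp add: nfar_kernel_def ident path_Suc del: nfar_path.simps)
qed

theorem theorem3p1: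
  fixes M :: "'w measure"
    and F :: "nat \<Rightarrow> 'w measure"
    and X :: "nat \<Rightarrow> 'w \<Rightarrow> 'h::{real_inner, banach, second_countable_topology}"
    and \<xi> :: "nat \<Rightarrow> 'w \<Rightarrow> 'h"
    and \<Psi>0 m0 Q :: "'h \<Rightarrow> 'h"
    and c1 c2 :: real
  assumes prob: "prob_space M"
    and filt_sub: "\<And>t. subalgebra M (F t)"
    and filt_mono: "\<And>s t. s \<le> t \<Longrightarrow> sets (F s) \<subseteq> sets (F t)"
    and Psi_meas: "\<Psi>0 \<in> borel_measurable borel"
    and model: "\<And>t \<omega>. \<omega> \<in> space M \<Longrightarrow> X (Suc t) \<omega> = \<Psi>0 (X t \<omega>) + \<xi> t \<omega>"
    and adapted: "\<And>t. X t \<in> borel_measurable (F t)"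
    and xi_meas: "\<And>t. \<xi> t \<in> borel_measurable (F (Suc t))"
    and xi_indep_past: "\<And>t. prob_space.indep_sets M
            (\<lambda>b. if b then sets (F t) else {\<xi> t -` A \<inter> space M | A. A \<in> sets borel}) UNIV"
    and xi_indep: "prob_space.indep_vars M (\<lambda>_. borel) \<xi> UNIV"
    and xi_ident: "\<And>t. distr M borel (\<xi> t) = distr M borel (\<xi> 0)"
    and xi_mean0: "\<And>t. integrable M (\<xi> t) \<and> integral\<^sup>L M (\<xi> t) = 0"
    and xi_trace: "integrable M (\<lambda>\<omega>. (norm (\<xi> 0 \<omega>))\<^sup>2)"
    and Q_lin: "bounded_linear Q"
    and Q_cov: "\<And>f g. Q f \<bullet> g = (\<integral>\<omega>. (\<xi> 0 \<omega> \<bullet> f) * (\<xi> 0 \<omega> \<bullet> g) \<partial>M)"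
    and G: "\<And>t. is_gaussian_measure 0 Q (distr M borel (\<xi> t))"
    and Qdense: "closure (range Q) = UNIV"
    and M1_meas: "m0 \<in> borel_measurable borel"
    and M1: "\<Psi>0 = Q \<circ> m0"
    and M2_pos: "c1 > 0" "c2 > 0"
    and M2_small: "c1 * onorm Q < 1"
    and M2_growth: "\<And>x. norm (m0 x) \<le> c1 * norm x + c2"
  shows "\<exists>\<pi>. invariant_prob (nfar_kernel M \<Psi>0 \<xi> 1) \<pi>
          \<and> (\<forall>\<pi>'. invariant_prob (nfar_kernel M \<Psi>0 \<xi> 1) \<pi>' \<longrightarrow> \<pi>' = \<pi>)
          \<and> (\<exists>\<gamma> C. 0 < \<gamma> \<and> \<gamma> < 1 \<and> C > 0 \<and>
               (\<forall>t x. (SUP \<phi>\<in>{\<phi> :: 'h \<Rightarrow> real. \<phi> \<in> borel_measurable borel \<and> (\<forall>z. \<bar>\<phi> z\<bar> \<le> 1)}.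
                          \<bar>(\<integral>z. \<phi> z \<partial>(nfar_kernel M \<Psi>0 \<xi> t x)) - (\<integral>z. \<phi> z \<partial>\<pi>)\<bar>)
                       \<le> C * \<gamma> ^ t * (1 + norm x)))"
proof -
  define \<mu> where "\<mu> = distr M borel (\<xi> 0)"
  define K where "K x = distr \<mu> borel (\<lambda>z. \<Psi>0 x + z)" for x
  \<comment> \<open>With V the norm, l and b are the drift constants: the bound on
    \<open>Q (m0 x)\<close> plus the mean norm of the noise. R exceeds
    \<open>2 * b / (1 - l)\<close> by 1 for strictness, and r bounds \<open>norm (m0 x)\<close> on
    the ball of radius R.\<close>
  define l where "l = c1 * onorm Q"
  define b where "b = onorm Q * c2 + (\<integral>z. norm z \<partial>\<mu>)"
  define R where "R = 2 * b / (1 - l) + 1"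
  define r where "r = c1 * R + c2"
  note [measurable] = Psi_meas
  have onorm_nonneg: "0 \<le> onorm Q" by (rule onorm_pos_le[OF Q_lin])
  have l: "0 \<le> l" "l < 1" using onorm_nonneg M2_pos M2_small by (simp_all add: l_def)
  have b: "0 \<le> b" using onorm_nonneg M2_pos by (simp add: b_def)
  have "(1 - l) * R = 2 * b + (1 - l)" using l by (simp add: R_def distrib_left)
  then have R: "2 * b < (1 - l) * R" "0 \<le> R" using l b by (simp_all add: R_def)
  have r: "0 \<le> r" using R M2_pos by (simp add: r_def)
  interpret centered_gaussian Q \<mu>
  proof (rule centered_gaussian.intro)
    show "is_gaussian_measure 0 Q \<mu>" using G by (simp add: \<mu>_def)
    show "linear Q" using Q_lin by (rule bounded_linear.linear)
    show "Q f \<bullet> g = f \<bullet> Q g" for f g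
      using Q_cov[of f g] Q_cov[of g f] by (simp add: inner_commute mult.commute)
    show "0 \<le> Q f \<bullet> f" for f by (simp add: Q_cov integral_nonneg)
  qed
  have norm_int: "integrable \<mu> (\<lambda>z. norm z)"
    using xi_mean0[of 0] measurable_from_subalg[OF filt_sub xi_meas, of 0]
    by (simp add: \<mu>_def integrable_distr_eq)
  have K_meas: "K \<in> borel \<rightarrow>\<^sub>M prob_algebra borel"
    unfolding K_def[abs_def]
    by (intro measurable_distr_prob_space2[where M=borel] measurable_const)
       (auto simp: space_prob_algebra prob_space_axioms)
  interpret harris K norm l b R "shift_minorizer r"
  proof (rule harris.intro)
    fix x
    have norm_le: "norm (\<Psi>0 x + z) \<le> l * norm x + onorm Q * c2 + norm z" for z
    proof -
      have "norm (\<Psi>0 x) \<le> onorm Q * norm (m0 x)" using onorm[OF Q_lin] by (simp add: M1)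
      also have "\<dots> \<le> onorm Q * (c1 * norm x + c2)" by (intro mult_left_mono M2_growth onorm_nonneg)
      also have "\<dots> = l * norm x + onorm Q * c2" by (simp add: l_def algebra_simps)
      finally show ?thesis using norm_triangle_ineq[of "\<Psi>0 x" z] by simp
    qed
    have sum_int: "integrable \<mu> (\<lambda>z. norm (\<Psi>0 x + z))"
    proof (rule Bochner_Integration.integrable_bound)
      show "integrable \<mu> (\<lambda>z. l * norm x + onorm Q * c2 + norm z)" using norm_int by simp
    qed (use norm_le order_trans[OF norm_le abs_ge_self] in auto)
    then show "integrable (K x) norm" by (simp add: K_def integrable_distr_eq)
    have "(\<integral>y. norm y \<partial>K x) = (\<integral>z. norm (\<Psi>0 x + z) \<partial>\<mu>)" unfolding K_def by (rule integral_distr) auto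
    also have "\<dots> \<le> (\<integral>z. l * norm x + onorm Q * c2 + norm z \<partial>\<mu>)"
      using sum_int norm_int norm_le by (intro integral_mono) auto
    also have "\<dots> = l * norm x + b" using norm_int prob_space by (simp add: b_def)
    finally show "(\<integral>y. norm y \<partial>K x) \<le> l * norm x + b" .
    fix A :: "'h set" assume x: "norm x \<le> R" and A: "A \<in> sets borel"
    have "norm (m0 x) \<le> r"
      using M2_growth[of x] mult_left_mono[OF x order.strict_implies_order[OF M2_pos(1)]] by (simp add: r_def)
    from shift_minorizer_le[OF Q_lin this] show "emeasure (shift_minorizer r) A \<le> emeasure (K x) A"
      using A by (subst (asm) le_measure) (auto simp: K_def M1)
  next
    show "sets (shift_minorizer r) = sets borel" by simp
    show "norm \<in> borel_measurable (borel :: 'h measure)" by measurable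
  qed (rule K_meas norm_ge_zero l b R shift_minorizer_subprob[OF Q_lin r] shift_minorizer_pos[OF Q_lin r])+
  have ident: "distr M borel (\<xi> t) = \<mu>" for t unfolding \<mu>_def by (rule xi_ident)
  have pow: "nfar_kernel M \<Psi>0 \<xi> t x = kernel_pow K t x" for t x
    unfolding K_def[abs_def]
    by (rule nfar_kernel_eq_kernel_pow[where F=F])
       (fact prob filt_sub filt_mono Psi_meas xi_meas xi_indep_past ident)+
  have K1: "nfar_kernel M \<Psi>0 \<xi> 1 = K"
    by (rule ext) (simp add: pow bind_return[OF measurable_prob_algebraD[OF K_meas]])
  obtain \<pi> \<gamma> C where "invariant_prob K \<pi>" "\<forall>\<pi>'. invariant_prob K \<pi>' \<longrightarrow> \<pi>' = \<pi>" "0 < \<gamma>" "\<gamma> < 1" "C > 0"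
    and *: "\<And>n x f. f \<in> borel_measurable borel \<Longrightarrow> (\<forall>z. \<bar>f z\<bar> \<le> 1) \<Longrightarrow>
      \<bar>(\<integral>z. f z \<partial>kernel_pow K n x) - (\<integral>z. f z \<partial>\<pi>)\<bar> \<le> C * \<gamma> ^ n * (1 + norm x)"
    using geometric_ergodicity by metis
  moreover have "(SUP \<phi>\<in>{\<phi> :: 'h \<Rightarrow> real. \<phi> \<in> borel_measurable borel \<and> (\<forall>z. \<bar>\<phi> z\<bar> \<le> 1)}.
      \<bar>(\<integral>z. \<phi> z \<partial>(nfar_kernel M \<Psi>0 \<xi> t x)) - (\<integral>z. \<phi> z \<partial>\<pi>)\<bar>) \<le> C * \<gamma> ^ t * (1 + norm x)" for t x
  proof (rule cSUP_least)
    have "(\<lambda>_. 0) \<in> {\<phi> :: 'h \<Rightarrow> real. \<phi> \<in> borel_measurable borel \<and> (\<forall>z. \<bar>\<phi> z\<bar> \<le> 1)}" by simp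
    then show "{\<phi> :: 'h \<Rightarrow> real. \<phi> \<in> borel_measurable borel \<and> (\<forall>z. \<bar>\<phi> z\<bar> \<le> 1)} \<noteq> {}" by blast
  qed (auto simp: pow *)
  ultimately show ?thesis unfolding K1 by blast
qed

end
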